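(* Consider the TGV regularized and perturbed primal problem $$\min_{u\in U,\,w\in V}\ \mathfrak{F}(u,w)=\tfrac12\|Ku-f_0\|_2^2+\tfrac{\nu}{2}\|\nabla u\|_2^2+\tfrac a2\|w\|_2^2+\alpha_1\|\nabla u-w\|_1+\alpha_0\|\mathcal{E}w\|_1$$ with $a,\alpha_0,\alpha_1>0$, $\nu\ge0$ and $H:=K^*K-\nu\Delta$ positive definite. Let $(u^k,w^k,h_1^k,h_2^k,\lambda^k,\mu^k)$ be the iteration sequence generated by the augmented Lagrangian method ALM-PDP described in the context, with the stopping criterion $$\Phi_k(u^{k+1},w^{k+1},h_1^{k+1},h_2^{k+1})-\inf\Phi_k\le\frac{\epsilon_k^2}{2\sigma_k},\qquad\sum_{k=0}^\infty\epsilon_k<\infty,\tag{A}$$ where $\Phi_k(u,w,h_1,h_2)=L_{\sigma_k}(u,w,h_1,h_2;\lambda^k,\mu^k)$. Then the sequence $(u^k,w^k,h_1^k,h_2^k,\lambda^k,\mu^k)$ is bounded and converges to some $(u^*,w^*,h_1^*,h_2^*,\lambda^*,\mu^* )$ which is a saddle point of the augmented Lagrangian $L_\sigma(u,w,h_1,h_2;\lambda,\mu)$. Under Assumption (E) of the context on a dual solution $(\bar\lambda,\bar\mu)$, $T_{\mathfrak{D}}:=\partial\mathfrak{D}$ is metrically subregular at $(\bar\lambda,\bar\mu)$ for the origin. Supposing the modulus is $\kappa_{\mathfrak{D}}$ and the additional stopping criterion $$\Phi_k(u^{k+1},w^{k+1},h_1^{k+1},h_2^{k+1})-\inf\Phi_k\le\frac{\delta_k^2}{2\sigma_k}\big(\|\lambda^{k+1}-\lambda^k\|^2+\|\mu^{k+1}-\mu^k\|^2\big),\qquad\sum_{k=0}^\infty\delta_k<+\infty,\tag{B1}$$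 is employed, the sequence $\xi^k=(\lambda^k,\mu^k)$ converges to $(\lambda^*,\mu^* )\in\mathcal{X}$ and, for all sufficiently large $k$, $$\operatorname{dist}(\xi^{k+1},\mathcal{X})\le\theta_k\operatorname{dist}(\xi^k,\mathcal{X}),\qquad\theta_k=\big[\kappa_{\mathfrak{D}}(\kappa_{\mathfrak{D}}^2+\sigma_k^2)^{-1/2}+\delta_k\big](1-\delta_k)^{-1},$$ where $\theta_k\to\theta_\infty=\kappa_{\mathfrak{D}}(\kappa_{\mathfrak{D}}^2+\sigma_\infty^2)^{-1/2}<1$ as $k\to\infty$.
   Context: Spaces. $\Omega$ is a finite pixel grid with $m$ pixels; $U=\{u:\Omega\to\mathbb{R}\}$, $V=\{w:\Omega\to\mathbb{R}^2\}$, $W=\{\mu:\Omega\to S^{2\times2}\}$ (symmetric matrices) identified with $\{\mu=(\mu^1,\mu^2,\mu^3):\Omega\to\mathbb{R}^3\}$, $\mu^3$ the off-diagonal entry. Pointwise inner products: $uv$ on $\mathbb{R}$, $\lambda^1s^1+\lambda^2s^2$ on $\mathbb{R}^2$, $\mu^1r^1+\mu^2r^2+2\mu^3r^3$ on $\mathbb{R}^3$, with induced pointwise norm $|\cdot|$; $\langle\cdot,\cdot\rangle_2$ and $\|\cdot\|=\|\cdot\|_2$ are obtained by summing over pixels; $\|\cdot\|_1=\sum_{\text{pixels}}|\cdot|$, $\|\cdot\|_\infty=\max_{\text{pixels}}|\cdot|$. Operators. $\partial_x^+,\partial_y^+$ are forward differences, $\nabla u=(\partial_x^+u,\partial_y^+u)$,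 $\mathcal{E}w=(\partial_x^+w^1,\partial_y^+w^2,\tfrac12(\partial_y^+w^1+\partial_x^+w^2))$; $\nabla^*=-\operatorname{div}$ and $\mathcal{E}^*$ are the adjoints, $-\Delta=\nabla^*\nabla$. $K$ is a linear operator on $U$, $f_0$ is given data, $f=K^*f_0$; $\nu=0$ if $K^*K$ is positive definite and $\nu>0$ otherwise. Augmented Lagrangian. For $\sigma>0$, $h_1,\lambda\in V$, $h_2,\mu\in W$, $$L_\sigma(u,w,h_1,h_2;\lambda,\mu)=\tfrac12\|Ku-f_0\|_2^2+\tfrac\nu2\|\nabla u\|_2^2+\tfrac a2\|w\|_2^2+\alpha_1\|h_1\|_1+\alpha_0\|h_2\|_1+\langle\lambda,\nabla u-w-h_1\rangle_2+\langle\mu,\mathcal{E}w-h_2\rangle_2+\tfrac\sigma2\|\nabla u-w-h_1\|_2^2+\tfrac\sigma2\|\mathcal{E}w-h_2\|_2^2.$$ A saddle point is understood with minimization in $(u,w,h_1,h_2)$ and maximization in $(\lambda,\mu)$. Algorithm (ALM-PDP). Given $\lambda^0,\mu^0,\sigma_0$ and step sizes $\sigma_{k+1}\ge\sigma_k>0$, $\sigma_k\to\sigma_\infty<+\infty$. At step $k$, a primal-dual semismooth Newton method, whose linear systems are solved iteratively by BiCGSTAB and whose dual iterates are projected onto $\{\|p\|_\infty\le\alpha_1\}$, $\{\|q\|_\infty\le\alpha_0\}$ after each Newton step, is applied to the optimality system of $\min\Phi_k$ in the unknowns $(u,w,p,q)$, $$Hu-f+\nabla^*p=0,\quad aw-p+\mathcal{E}^*q=0,\quad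 p=\mathcal{P}_{\alpha_1}(\lambda^k+\sigma_k(\nabla u-w)),\quad q=\mathcal{P}_{\alpha_0}(\mu^k+\sigma_k\mathcal{E}w),$$ where $\mathcal{P}_\alpha(z)=z/\max(1,|z|/\alpha)$ pointwise. The initial value of the Newton method (usually taken from the previous outer step) is supposed sufficiently close to the solution of this system, which gives local superlinear convergence of the Newton iterates. The output is $(u^{k+1},w^{k+1},p^{k+1},q^{k+1})$; the multipliers are updated by $\lambda^{k+1}=p^{k+1}$, $\mu^{k+1}=q^{k+1}$, with $h_1^{k+1},h_2^{k+1}$ related to them by $\lambda^{k+1}=\lambda^k+\sigma_k(\nabla u^{k+1}-w^{k+1}-h_1^{k+1})$, $\mu^{k+1}=\mu^k+\sigma_k(\mathcal{E}w^{k+1}-h_2^{k+1})$. Dual problem. $\max_{\lambda\in V,\mu\in W}-\mathfrak{D}(\lambda,\mu)$ with $$\mathfrak{D}(\lambda,\mu)=\tfrac12\|\operatorname{div}\lambda+K^*f_0\|_{H^{-1}}^2-\tfrac12\|f_0\|_2^2+\tfrac1{2a}\|\lambda-\mathcal{E}^*\mu\|_2^2+\mathcal{I}_{\{\|\lambda\|_\infty\le\alpha_1\}}(\lambda)+\mathcal{I}_{\{\|\mu\|_\infty\le\alpha_0\}}(\mu),$$ where $\|v\|_{H^{-1}}^2=\langle H^{-1}v,v\rangle_2$ and $\mathcal{I}_C$ is $0$ on $C$, $+\infty$ off $C$. $\mathcal{X}$ denotes its solution set; $\operatorname{dist}(x,C)=\inf\{\|x-x'\|:x'\in C\}$. Assumption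 (E). $(\bar\lambda,\bar\mu)\in\mathcal{X}$ and, with $i=1,\dots,m$ indexing pixels: (i) for each $\bar\lambda_i$, either $|\bar\lambda_i|<\alpha_1$, or $|\bar\lambda_i|=\alpha_1$ and there exists $\bar g_i\ne0$ in the normal cone at $\bar\lambda_i$ to the ball $\{\tilde\lambda\in\mathbb{R}^2:|\tilde\lambda|\le\alpha_1\}$; (ii) for each $\bar\mu_i$, either $|\bar\mu_i|<\alpha_0$, or $|\bar\mu_i|=\alpha_0$ and there exists $\bar\psi_i\ne0$ in the normal cone at $\bar\mu_i$ to the ball $\{\tilde\mu\in\mathbb{R}^3:|\tilde\mu|\le\alpha_0\}$. Metric subregularity. A set-valued map $F:X\rightrightarrows Y$ is metrically subregular at $\bar x$ for $\bar y$ with modulus $\kappa\ge0$ if $\bar y\in F(\bar x)$ and there are neighborhoods $U'$ of $\bar x$, $V'$ of $\bar y$ with $\operatorname{dist}(x,F^{-1}(\bar y))\le\kappa\operatorname{dist}(\bar y,F(x)\cap V')$ for all $x\in U'$.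
   Formalization: In Assumption (E), the normals (g,ψ) must be minus the gradient of the smooth part of D at the dual solution (arbitrary nonzero normals always exist and subregularity can then fail); the rate is claimed when κ_D is also a modulus of subregularity at the limit (λ*,μ* ). *)

theory Defs
  imports "HOL-Analysis.Analysis"
begin

section \<open>Symmetric matrices of size two\<close>

text \<open>The third component is the off-diagonal entry, so that the inner product
  below is the Frobenius inner product.\<close>

datatype sym2 = Sym2 (s11: real) (s22: real) (s12: real)

lemma sym2_eq_iff: "x = y \<longleftrightarrow> s11 x = s11 y \<and> s22 x = s22 y \<and> s12 x = s12 y"
  by (cases x; cases y) simp

instantiation sym2 :: real_vector
begin

definition zero_sym2 :: sym2 where "0 = Sym2 0 0 0"
definition plus_sym2 :: "sym2 \<Rightarrow> sym2 \<Rightarrow> sym2" where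
  "x + y = Sym2 (s11 x + s11 y) (s22 x + s22 y) (s12 x + s12 y)"
definition uminus_sym2 :: "sym2 \<Rightarrow> sym2" where
  "- x = Sym2 (- s11 x) (- s22 x) (- s12 x)"
definition minus_sym2 :: "sym2 \<Rightarrow> sym2 \<Rightarrow> sym2" where
  "x - y = Sym2 (s11 x - s11 y) (s22 x - s22 y) (s12 x - s12 y)"
definition scaleR_sym2 :: "real \<Rightarrow> sym2 \<Rightarrow> sym2" where
  "r *\<^sub>R x = Sym2 (r * s11 x) (r * s22 x) (r * s12 x)"

instance
  by standard
    (simp_all add: sym2_eq_iff zero_sym2_def plus_sym2_def uminus_sym2_def minus_sym2_def
      scaleR_sym2_def algebra_simps)

end

lemma sym2_sel [simp]:
  "s11 0 = 0" "s22 0 = 0" "s12 0 = 0"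
  "s11 (x + y) = s11 x + s11 y" "s22 (x + y) = s22 x + s22 y" "s12 (x + y) = s12 x + s12 y"
  "s11 (- x) = - s11 x" "s22 (- x) = - s22 x" "s12 (- x) = - s12 x"
  "s11 (x - y) = s11 x - s11 y" "s22 (x - y) = s22 x - s22 y" "s12 (x - y) = s12 x - s12 y"
  "s11 (r *\<^sub>R x) = r * s11 x" "s22 (r *\<^sub>R x) = r * s22 x" "s12 (r *\<^sub>R x) = r * s12 x"
  by (simp_all add: zero_sym2_def plus_sym2_def uminus_sym2_def minus_sym2_def scaleR_sym2_def)

instantiation sym2 :: real_inner
begin

definition inner_sym2 :: "sym2 \<Rightarrow> sym2 \<Rightarrow> real" where
  "x \<bullet> y = s11 x * s11 y + s22 x * s22 y + 2 * (s12 x * s12 y)"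
definition norm_sym2 :: "sym2 \<Rightarrow> real" where
  "norm (x::sym2) = sqrt (x \<bullet> x)"
definition sgn_sym2 :: "sym2 \<Rightarrow> sym2" where
  "sgn (x::sym2) = inverse (norm x) *\<^sub>R x"
definition dist_sym2 :: "sym2 \<Rightarrow> sym2 \<Rightarrow> real" where
  "dist (x::sym2) y = norm (x - y)"
definition uniformity_sym2 :: "(sym2 \<times> sym2) filter" where
  "(uniformity :: (sym2 \<times> sym2) filter) = (INF e\<in>{0<..}. principal {(x, y). dist x y < e})"
definition open_sym2 :: "sym2 set \<Rightarrow> bool" where
  "open (S :: sym2 set) \<longleftrightarrow> (\<forall>x\<in>S. \<forall>\<^sub>F (x', y) in uniformity. x' = x \<longrightarrow> y \<in> S)"

instance
proof
  fix x y z :: sym2 and r :: real and S :: "sym2 set"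
  show "dist x y = norm (x - y)" by (rule dist_sym2_def)
  show "sgn x = x /\<^sub>R norm x" by (simp add: sgn_sym2_def)
  show "(uniformity :: (sym2 \<times> sym2) filter) = (INF e\<in>{0<..}. principal {(x, y). dist x y < e})"
    by (rule uniformity_sym2_def)
  show "open S \<longleftrightarrow> (\<forall>x\<in>S. \<forall>\<^sub>F (x', y) in uniformity. x' = x \<longrightarrow> y \<in> S)"
    by (rule open_sym2_def)
  show "x \<bullet> y = y \<bullet> x" by (simp add: inner_sym2_def mult.commute)
  show "(x + y) \<bullet> z = x \<bullet> z + y \<bullet> z" by (simp add: inner_sym2_def algebra_simps)
  show "(r *\<^sub>R x) \<bullet> y = r * (x \<bullet> y)" by (simp add: inner_sym2_def algebra_simps)
  show "0 \<le> x \<bullet> x" by (simp add: inner_sym2_def)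
  show "x \<bullet> x = 0 \<longleftrightarrow> x = 0"
  proof
    assume "x \<bullet> x = 0"
    then have "s11 x * s11 x + (s22 x * s22 x + 2 * (s12 x * s12 x)) = 0"
      by (simp add: inner_sym2_def)
    moreover have "0 \<le> s11 x * s11 x" "0 \<le> s22 x * s22 x" "0 \<le> s12 x * s12 x" by simp_all
    ultimately have "s11 x * s11 x = 0" "s22 x * s22 x = 0" "s12 x * s12 x = 0" by linarith+
    then show "x = 0" by (simp add: sym2_eq_iff)
  qed (simp add: inner_sym2_def)
  show "norm x = sqrt (x \<bullet> x)" by (rule norm_sym2_def)
qed

end

instantiation sym2 :: euclidean_space
begin

definition Basis_sym2 :: "sym2 set" where
  "Basis = {Sym2 1 0 0, Sym2 0 1 0, Sym2 0 0 (1 / sqrt 2)}"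

instance
proof
  have sq: "2 * (1 / sqrt 2 * (1 / sqrt 2)) = (1::real)"
    by (simp add: field_simps)
  have ne: "1 / sqrt 2 \<noteq> (0::real)" by simp
  define r where "r = 1 / sqrt (2::real)"
  have r: "2 * (r * r) = 1" "r \<noteq> 0"
    unfolding r_def by (rule sq, rule ne)
  have Basis: "(Basis :: sym2 set) = {Sym2 1 0 0, Sym2 0 1 0, Sym2 0 0 r}"
    by (simp only: Basis_sym2_def r_def)
  show "(Basis :: sym2 set) \<noteq> {}" "finite (Basis :: sym2 set)"
    by (simp_all add: Basis)
  fix u v :: sym2
  show "u \<bullet> v = (if u = v then 1 else 0)" if "u \<in> Basis" "v \<in> Basis"
    using that unfolding Basis by (elim insertE emptyE; simp add: inner_sym2_def r)
  show "(\<forall>v\<in>Basis. u \<bullet> v = 0) \<longleftrightarrow> u = 0"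
    using r(2) by (cases u) (simp add: Basis inner_sym2_def zero_sym2_def)
qed

end


section \<open>Pixel grid and difference operators\<close>

text \<open>The grid is the product of two finite chains. Under the standard inner product of
  \<open>real ^ 'p\<close>, \<open>(real ^ 2) ^ 'p\<close> and \<open>sym2 ^ 'p\<close> the library norm is the norm written with
  index 2, and \<^const>\<open>adjoint\<close> is the adjoint with respect to these inner products.\<close>

type_synonym ('i, 'j) U = "real ^ ('i \<times> 'j)"
type_synonym ('i, 'j) V = "(real ^ 2) ^ ('i \<times> 'j)"
type_synonym ('i, 'j) W = "sym2 ^ ('i \<times> 'j)"

text \<open>The last element is its own successor, which makes the forward difference vanish at
  the far boundary (homogeneous Neumann condition).\<close>

definition next_ix :: "'a::{finite,linorder} \<Rightarrow> 'a" where
  "next_ix i = (if \<exists>j. i < j then Min {j. i < j} else i)"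

definition dx :: "('i::{finite,linorder}, 'j::{finite,linorder}) U \<Rightarrow> ('i, 'j) U" where
  "dx u = (\<chi> c. u $ (next_ix (fst c), snd c) - u $ c)"

definition dy :: "('i::{finite,linorder}, 'j::{finite,linorder}) U \<Rightarrow> ('i, 'j) U" where
  "dy u = (\<chi> c. u $ (fst c, next_ix (snd c)) - u $ c)"

definition grad :: "('i::{finite,linorder}, 'j::{finite,linorder}) U \<Rightarrow> ('i, 'j) V" where
  "grad u = (\<chi> c. vector [dx u $ c, dy u $ c])"

definition component :: "2 \<Rightarrow> ('i::{finite,linorder}, 'j::{finite,linorder}) V \<Rightarrow> ('i, 'j) U" where
  "component l w = (\<chi> c. w $ c $ l)"

definition symgrad :: "('i::{finite,linorder}, 'j::{finite,linorder}) V \<Rightarrow> ('i, 'j) W" where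
  "symgrad w = (\<chi> c. Sym2 (dx (component 1 w) $ c) (dy (component 2 w) $ c)
                         (1/2 * (dy (component 1 w) $ c + dx (component 2 w) $ c)))"

definition dvg :: "('i::{finite,linorder}, 'j::{finite,linorder}) V \<Rightarrow> ('i, 'j) U" where
  "dvg p = - adjoint grad p"

definition laplace :: "('i::{finite,linorder}, 'j::{finite,linorder}) U \<Rightarrow> ('i, 'j) U" where
  "laplace u = dvg (grad u)"

definition norm1 :: "('a::real_normed_vector) ^ 'p \<Rightarrow> real" where
  "norm1 z = (\<Sum>c\<in>UNIV. norm (z $ c))"

definition norm_inf :: "('a::real_normed_vector) ^ 'p \<Rightarrow> real" where
  "norm_inf z = Max (range (\<lambda>c. norm (z $ c)))"

definition proj_ball :: "real \<Rightarrow> ('a::real_normed_vector) ^ 'p \<Rightarrow> 'a ^ 'p" where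
  "proj_ball \<alpha> z = (\<chi> c. z $ c /\<^sub>R max 1 (norm (z $ c) / \<alpha>))"

definition H_op :: "(('i, 'j) U \<Rightarrow> ('i, 'j) U) \<Rightarrow> real
    \<Rightarrow> ('i::{finite,linorder}, 'j::{finite,linorder}) U \<Rightarrow> ('i, 'j) U" where
  "H_op K \<nu> u = adjoint K (K u) - \<nu> *\<^sub>R laplace u"

definition positive_definite :: "('a::real_inner \<Rightarrow> 'a) \<Rightarrow> bool" where
  "positive_definite A \<longleftrightarrow> (\<forall>x. x \<noteq> 0 \<longrightarrow> 0 < A x \<bullet> x)"


section \<open>Augmented Lagrangian\<close>

definition aug_lagrangian ::
  "(('i, 'j) U \<Rightarrow> ('i, 'j) U) \<Rightarrow> ('i, 'j) U \<Rightarrow> real \<Rightarrow> real \<Rightarrow> real \<Rightarrow> real \<Rightarrow> real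
    \<Rightarrow> ('i::{finite,linorder}, 'j::{finite,linorder}) U \<times> ('i, 'j) V \<times> ('i, 'j) V \<times> ('i, 'j) W
    \<Rightarrow> ('i, 'j) V \<times> ('i, 'j) W \<Rightarrow> real" where
  "aug_lagrangian K f0 \<nu> a \<alpha>0 \<alpha>1 \<sigma> = (\<lambda>(u, w, h1, h2) (lam, mu).
     1/2 * (norm (K u - f0))\<^sup>2 + \<nu>/2 * (norm (grad u))\<^sup>2 + a/2 * (norm w)\<^sup>2
     + \<alpha>1 * norm1 h1 + \<alpha>0 * norm1 h2
     + lam \<bullet> (grad u - w - h1) + mu \<bullet> (symgrad w - h2)
     + \<sigma>/2 * (norm (grad u - w - h1))\<^sup>2 + \<sigma>/2 * (norm (symgrad w - h2))\<^sup>2)"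

definition saddle_point :: "('x \<Rightarrow> 'y \<Rightarrow> real) \<Rightarrow> 'x \<Rightarrow> 'y \<Rightarrow> bool" where
  "saddle_point L xs ys \<longleftrightarrow> (\<forall>x y. L xs y \<le> L xs ys \<and> L xs ys \<le> L x ys)"


section \<open>The algorithm\<close>

text \<open>A Newton derivative (slant derivative) is a choice of linear maps near \<open>x\<close>, not only
  at \<open>x\<close>: the linear map is evaluated at the displaced point.\<close>

definition newton_derivative ::
  "('a::real_normed_vector \<Rightarrow> 'b::real_normed_vector) \<Rightarrow> ('a \<Rightarrow> 'a \<Rightarrow> 'b) \<Rightarrow> bool" where
  "newton_derivative F G \<longleftrightarrow> (\<forall>x. linear (G x)) \<and>
     (\<forall>x. ((\<lambda>h. norm (F (x + h) - F x - G (x + h) h) / norm h) \<longlongrightarrow> 0) (at 0))"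

definition superlinearly_convergent :: "(nat \<Rightarrow> 'a::real_normed_vector) \<Rightarrow> 'a \<Rightarrow> bool" where
  "superlinearly_convergent z zs \<longleftrightarrow> z \<longlonglongrightarrow> zs \<and>
     (\<exists>c. c \<longlonglongrightarrow> 0 \<and> (\<forall>l. norm (z (Suc l) - zs) \<le> c l * norm (z l - zs)))"

text \<open>Projected semismooth Newton iterates for \<open>F z = 0\<close>. The linear systems are solved
  iteratively, up to a relative residual \<open>\<eta> l < 1\<close>; that the start is close enough to the
  solution enters as superlinear convergence of the iterates.\<close>

definition ssn_iterates ::
  "('a::real_normed_vector \<Rightarrow> 'b::real_normed_vector) \<Rightarrow> ('a \<Rightarrow> 'a) \<Rightarrow> (nat \<Rightarrow> 'a) \<Rightarrow> bool" where
  "ssn_iterates F Pr z \<longleftrightarrow>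
     (\<exists>G \<eta>. newton_derivative F G \<and>
        (\<forall>l. 0 \<le> \<eta> l \<and> \<eta> l < 1 \<and>
             (\<exists>d. norm (G (z l) d + F (z l)) \<le> \<eta> l * norm (F (z l)) \<and> z (Suc l) = Pr (z l + d)))) \<and>
     (\<exists>zs. F zs = 0 \<and> superlinearly_convergent z zs)"

definition opt_residual ::
  "(('i, 'j) U \<Rightarrow> ('i, 'j) U) \<Rightarrow> ('i, 'j) U \<Rightarrow> real \<Rightarrow> real \<Rightarrow> real \<Rightarrow> real \<Rightarrow> real
    \<Rightarrow> ('i, 'j) V \<Rightarrow> ('i, 'j) W
    \<Rightarrow> ('i::{finite,linorder}, 'j::{finite,linorder}) U \<times> ('i, 'j) V \<times> ('i, 'j) V \<times> ('i, 'j) W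
    \<Rightarrow> ('i, 'j) U \<times> ('i, 'j) V \<times> ('i, 'j) V \<times> ('i, 'j) W" where
  "opt_residual K f0 \<nu> a \<alpha>0 \<alpha>1 \<sigma> lam mu = (\<lambda>(u, w, p, q).
     (H_op K \<nu> u - adjoint K f0 + adjoint grad p,
      a *\<^sub>R w - p + adjoint symgrad q,
      p - proj_ball \<alpha>1 (lam + \<sigma> *\<^sub>R (grad u - w)),
      q - proj_ball \<alpha>0 (mu + \<sigma> *\<^sub>R symgrad w)))"

definition proj_dual :: "real \<Rightarrow> real \<Rightarrow> ('i, 'j) U \<times> ('i, 'j) V \<times> ('i, 'j) V \<times> ('i, 'j) W
    \<Rightarrow> ('i::{finite,linorder}, 'j::{finite,linorder}) U \<times> ('i, 'j) V \<times> ('i, 'j) V \<times> ('i, 'j) W" where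
  "proj_dual \<alpha>0 \<alpha>1 = (\<lambda>(u, w, p, q). (u, w, proj_ball \<alpha>1 p, proj_ball \<alpha>0 q))"

text \<open>The inner solver stops after some number \<open>n k \<ge> 1\<close> of Newton steps, and its dual
  output becomes the new multiplier. In general the output does not satisfy the optimality
  system exactly, so that \<open>h1\<close> and \<open>h2\<close>, which are determined by the last two equations,
  need not minimize the augmented Lagrangian for the computed \<open>u\<close> and \<open>w\<close>.\<close>

definition alm_pdp ::
  "(('i, 'j) U \<Rightarrow> ('i, 'j) U) \<Rightarrow> ('i, 'j) U \<Rightarrow> real \<Rightarrow> real \<Rightarrow> real \<Rightarrow> real
    \<Rightarrow> (nat \<Rightarrow> real)
    \<Rightarrow> (nat \<Rightarrow> ('i::{finite,linorder}, 'j::{finite,linorder}) U) \<Rightarrow> (nat \<Rightarrow> ('i, 'j) V)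
    \<Rightarrow> (nat \<Rightarrow> ('i, 'j) V) \<Rightarrow> (nat \<Rightarrow> ('i, 'j) W)
    \<Rightarrow> (nat \<Rightarrow> ('i, 'j) V) \<Rightarrow> (nat \<Rightarrow> ('i, 'j) W) \<Rightarrow> bool" where
  "alm_pdp K f0 \<nu> a \<alpha>0 \<alpha>1 \<sigma> u w h1 h2 lam mu \<longleftrightarrow>
     (\<exists>p q. \<forall>k.
        (\<exists>z n. ssn_iterates (opt_residual K f0 \<nu> a \<alpha>0 \<alpha>1 (\<sigma> k) (lam k) (mu k))
                 (proj_dual \<alpha>0 \<alpha>1) z \<and>
               1 \<le> n \<and> z n = (u (Suc k), w (Suc k), p (Suc k), q (Suc k))) \<and>
        lam (Suc k) = p (Suc k) \<and> mu (Suc k) = q (Suc k) \<and>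
        lam (Suc k) = lam k + \<sigma> k *\<^sub>R (grad (u (Suc k)) - w (Suc k) - h1 (Suc k)) \<and>
        mu (Suc k) = mu k + \<sigma> k *\<^sub>R (symgrad (w (Suc k)) - h2 (Suc k)))"


section \<open>Dual problem\<close>

definition indicator_fun :: "'a set \<Rightarrow> 'a \<Rightarrow> ereal" where
  "indicator_fun C x = (if x \<in> C then 0 else \<infinity>)"

definition dual_smooth ::
  "(('i, 'j) U \<Rightarrow> ('i, 'j) U) \<Rightarrow> ('i, 'j) U \<Rightarrow> real \<Rightarrow> real
    \<Rightarrow> ('i::{finite,linorder}, 'j::{finite,linorder}) V \<times> ('i, 'j) W \<Rightarrow> real" where
  "dual_smooth K f0 \<nu> a = (\<lambda>(lam, mu).
     1/2 * (inv (H_op K \<nu>) (dvg lam + adjoint K f0) \<bullet> (dvg lam + adjoint K f0))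
     - 1/2 * (norm f0)\<^sup>2 + 1 / (2 * a) * (norm (lam - adjoint symgrad mu))\<^sup>2)"

definition dual_fun ::
  "(('i, 'j) U \<Rightarrow> ('i, 'j) U) \<Rightarrow> ('i, 'j) U \<Rightarrow> real \<Rightarrow> real \<Rightarrow> real \<Rightarrow> real
    \<Rightarrow> ('i::{finite,linorder}, 'j::{finite,linorder}) V \<times> ('i, 'j) W \<Rightarrow> ereal" where
  "dual_fun K f0 \<nu> a \<alpha>0 \<alpha>1 = (\<lambda>(lam, mu).
     ereal (dual_smooth K f0 \<nu> a (lam, mu))
     + indicator_fun {l. norm_inf l \<le> \<alpha>1} lam + indicator_fun {m. norm_inf m \<le> \<alpha>0} mu)"

definition dual_solutions ::
  "(('i, 'j) U \<Rightarrow> ('i, 'j) U) \<Rightarrow> ('i, 'j) U \<Rightarrow> real \<Rightarrow> real \<Rightarrow> real \<Rightarrow> real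
    \<Rightarrow> (('i::{finite,linorder}, 'j::{finite,linorder}) V \<times> ('i, 'j) W) set" where
  "dual_solutions K f0 \<nu> a \<alpha>0 \<alpha>1 =
     {x. \<forall>y. - dual_fun K f0 \<nu> a \<alpha>0 \<alpha>1 y \<le> - dual_fun K f0 \<nu> a \<alpha>0 \<alpha>1 x}"

definition subdifferential :: "('a::real_inner \<Rightarrow> ereal) \<Rightarrow> 'a \<Rightarrow> 'a set" where
  "subdifferential f x = {v. \<bar>f x\<bar> \<noteq> \<infinity> \<and> (\<forall>y. f x + ereal (v \<bullet> (y - x)) \<le> f y)}"

definition normal_cone :: "'a::real_inner set \<Rightarrow> 'a \<Rightarrow> 'a set" where
  "normal_cone C x = (if x \<in> C then {g. \<forall>y\<in>C. g \<bullet> (y - x) \<le> 0} else {})"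

text \<open>The normals \<open>g\<close>, \<open>\<psi>\<close> are those of the optimality condition: \<open>(lam, mu)\<close> solves the dual
  problem iff minus the gradient of the smooth part of the dual function is normal to the
  constraint set, and \<open>(g, \<psi>)\<close> is this vector. For an arbitrary nonzero element of the normal
  cone the alternatives would hold trivially, as every point on the boundary of a ball
  has a nonzero normal.\<close>

definition assumption_E ::
  "(('i, 'j) U \<Rightarrow> ('i, 'j) U) \<Rightarrow> ('i, 'j) U \<Rightarrow> real \<Rightarrow> real \<Rightarrow> real \<Rightarrow> real
    \<Rightarrow> ('i::{finite,linorder}, 'j::{finite,linorder}) V \<Rightarrow> ('i, 'j) W \<Rightarrow> bool" where
  "assumption_E K f0 \<nu> a \<alpha>0 \<alpha>1 lam mu \<longleftrightarrow>
     (lam, mu) \<in> dual_solutions K f0 \<nu> a \<alpha>0 \<alpha>1 \<and>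
     (\<exists>g \<psi>. GDERIV (dual_smooth K f0 \<nu> a) (lam, mu) :> - (g, \<psi>) \<and>
        (\<forall>i. norm (lam $ i) < \<alpha>1 \<or>
             norm (lam $ i) = \<alpha>1 \<and> g $ i \<noteq> 0 \<and> g $ i \<in> normal_cone (cball 0 \<alpha>1) (lam $ i)) \<and>
        (\<forall>i. norm (mu $ i) < \<alpha>0 \<or>
             norm (mu $ i) = \<alpha>0 \<and> \<psi> $ i \<noteq> 0 \<and> \<psi> $ i \<in> normal_cone (cball 0 \<alpha>0) (mu $ i)))"

text \<open>The distance to the empty set is infinite, whereas \<^const>\<open>infdist\<close> is then 0. So the
  inequality is only required if \<open>F x \<inter> V'\<close> is nonempty.\<close>

definition metrically_subregular ::
  "('a::metric_space \<Rightarrow> 'b::metric_space set) \<Rightarrow> 'a \<Rightarrow> 'b \<Rightarrow> real \<Rightarrow> bool" where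
  "metrically_subregular F xb yb \<kappa> \<longleftrightarrow> 0 \<le> \<kappa> \<and> yb \<in> F xb \<and>
     (\<exists>U' V'. open U' \<and> xb \<in> U' \<and> open V' \<and> yb \<in> V' \<and>
        (\<forall>x\<in>U'. F x \<inter> V' \<noteq> {} \<longrightarrow> infdist x {x'. yb \<in> F x'} \<le> \<kappa> * infdist yb (F x \<inter> V')))"

end

theory Submission
  imports Defs
begin

text \<open>The augmented Lagrangian method is the proximal point iteration for the dual problem, and the
  stopping criteria bound the error of each proximal step. Write \<open>\<xi> = (lam, mu)\<close>, and write
  \<open>A x = (grad u - w - h1, symgrad w - h2)\<close> for the constraint map. The multiplier update is
  \<open>\<xi>' = \<xi> + \<sigma> A x\<close> for whatever primal point \<open>x\<close> the inner solver returns. At a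
  solution \<open>x\<close> of the optimality system the same update gives the point \<open>\<eta>\<close> with
  \<open>\<xi> - \<eta> \<in> \<sigma> T \<eta>\<close>, where \<open>T\<close> is the subdifferential of the dual function. The augmented
  Lagrangian grows quadratically around this exact \<open>x\<close>: in \<open>u\<close> through \<open>H\<close>, in \<open>w\<close> through
  \<open>a\<close>, and in \<open>A x\<close> through the penalty (\<open>lagrangian_growth\<close>). So the excess of the
  computed point over the infimum controls both \<open>norm (\<xi>' - \<eta>)\<close> and the distance of \<open>(u, w)\<close>
  to the exact pair (\<open>inexact_step\<close>). The exact solution itself is the limit of the
  inner Newton iterates.

  Convergence is then that of an inexact proximal point method with summable errors, for a
  monotone map with closed graph that has a zero (\<open>inexact_proximal_point_convergence\<close>). The
  dual function has a minimizer since the multipliers range over products of balls. The primal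
  variables follow, as \<open>u\<close> and \<open>w\<close> are affine functions of the multipliers up to vanishing errors,
  and \<open>h1\<close>, \<open>h2\<close> are recovered from the multiplier update. The limit is a saddle point by the
  growth estimate once more, now with \<open>A x = 0\<close>.

  The linear rate balances two facts about one exact proximal step: a long step uses up a share of
  the distance to the solution set, and a short one is possible only near that set, by metric
  subregularity (\<open>prox_step_contracts_infdist\<close>).

  Metric subregularity itself comes from quadratic growth of the dual function around its solution
  set. The smooth part grows in all directions except a linear subspace. At pixels where the normal
  vector of the optimality condition is nonzero, the curvature of the ball makes the linear part of
  the dual function grow quadratically along the ball (\<open>cball_quadratic_growth\<close>). At the other pixels the assumption places the solution in the interior of the
  ball, so that the solution set is, near the given solution, an affine subspace, and the growth
  holds in all directions orthogonal to it (\<open>dual_metrically_subregular\<close>).\<close>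


section \<open>Inexact proximal iterations for monotone set-valued maps\<close>

definition monotone_operator :: "('a::real_inner \<Rightarrow> 'a set) \<Rightarrow> bool" where
  "monotone_operator T \<longleftrightarrow> (\<forall>x y. \<forall>v\<in>T x. \<forall>w\<in>T y. 0 \<le> (v - w) \<bullet> (x - y))"

lemma le_mult_infdistI:
  assumes "A \<noteq> {}" "0 \<le> c" "\<And>y. y \<in> A \<Longrightarrow> b \<le> c * dist x y"
  shows "b \<le> c * infdist x A"
proof (cases "c = 0")
  case True
  then show ?thesis using assms by auto
next
  case False
  with assms(2) have "c > 0" by simp
  then have "b / c \<le> infdist x A"
    unfolding infdist_notempty[OF assms(1)] using assms
    by (intro cINF_greatest) (auto simp: field_simps)
  then show ?thesis using \<open>c > 0\<close> by (simp add: field_simps)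
qed

text \<open>Firm nonexpansiveness of the resolvent, seen from a zero \<open>z\<close>: as \<open>x - y\<close> is a positive
  multiple of an element of \<open>T y\<close>, monotonicity excludes an obtuse angle between \<open>x - y\<close> and \<open>y - z\<close>.\<close>

lemma prox_step_fejer:
  assumes T: "monotone_operator T" and z: "0 \<in> T z"
    and y: "(1 / \<sigma>) *\<^sub>R (x - y) \<in> T y" and \<sigma>: "0 < (\<sigma>::real)"
  shows "(norm (y - z))\<^sup>2 + (norm (y - x))\<^sup>2 \<le> (norm (x - z))\<^sup>2"
proof -
  have "0 \<le> ((1 / \<sigma>) *\<^sub>R (x - y) - 0) \<bullet> (y - z)"
    using T z y unfolding monotone_operator_def by blast
  then have "0 \<le> (x - y) \<bullet> (y - z)"
    using \<sigma> by (simp add: zero_le_mult_iff zero_le_divide_iff)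
  then show ?thesis
    unfolding power2_norm_eq_inner by (simp add: inner_diff_left inner_diff_right inner_commute)
qed

lemma almost_decreasing_convergent:
  fixes a e :: "nat \<Rightarrow> real"
  assumes "\<And>k. 0 \<le> a k" "\<And>k. a (Suc k) \<le> a k + e k" "summable e" "\<And>k. 0 \<le> e k"
  shows "convergent a"
proof -
  define b where "b k = a k - sum e {..<k}" for k
  have "decseq b"
    unfolding decseq_Suc_iff b_def using assms(2) by (simp add: algebra_simps)
  moreover have "- suminf e \<le> b k" for k
    using assms(1)[of k] sum_le_suminf[OF assms(3), of "{..<k}"] assms(4) by (simp add: b_def)
  ultimately obtain l where "b \<longlonglongrightarrow> l" using decseq_convergent by metis
  then have "(\<lambda>k. b k + sum e {..<k}) \<longlonglongrightarrow> l + suminf e"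
    by (intro tendsto_add summable_LIMSEQ assms)
  then show ?thesis unfolding b_def convergent_def by auto
qed

text \<open>The distance to every zero converges by the Fejer estimate. Since the steps then tend to
  zero, the closed graph makes every accumulation point a zero, and the distance to that zero
  tends to 0 along the whole sequence.\<close>

proposition inexact_proximal_point_convergence:
  fixes \<xi> \<eta> :: "nat \<Rightarrow> 'a::euclidean_space"
  assumes T: "monotone_operator T" and cl: "closed {(x, v). v \<in> T x}" and z0: "0 \<in> T z0"
    and \<sigma>: "\<And>k. s \<le> \<sigma> k" "0 < s"
    and step: "\<And>k. (1 / \<sigma> k) *\<^sub>R (\<xi> k - \<eta> k) \<in> T (\<eta> k)"
    and err: "\<And>k. norm (\<xi> (Suc k) - \<eta> k) \<le> \<epsilon> k" and \<epsilon>: "summable \<epsilon>"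
  obtains xs where "\<xi> \<longlonglongrightarrow> xs" "\<eta> \<longlonglongrightarrow> xs" "0 \<in> T xs"
    "(\<lambda>k. (1 / \<sigma> k) *\<^sub>R (\<xi> k - \<eta> k)) \<longlonglongrightarrow> 0"
proof -
  have \<sigma>pos: "0 < \<sigma> k" for k using \<sigma>(1)[of k] \<sigma>(2) by simp
  have \<epsilon>nn: "0 \<le> \<epsilon> k" for k using norm_ge_zero[of "\<xi> (Suc k) - \<eta> k"] err[of k] by linarith
  have \<epsilon>0: "\<epsilon> \<longlonglongrightarrow> 0" by (rule summable_LIMSEQ_zero[OF \<epsilon>])
  have fejer: "(norm (\<eta> k - z))\<^sup>2 + (norm (\<eta> k - \<xi> k))\<^sup>2 \<le> (norm (\<xi> k - z))\<^sup>2" if "0 \<in> T z" for z k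
    by (rule prox_step_fejer[OF T that step \<sigma>pos])
  have \<eta>le: "norm (\<eta> k - z) \<le> norm (\<xi> k - z)" if "0 \<in> T z" for z k
  proof (rule power2_le_imp_le)
    show "(norm (\<eta> k - z))\<^sup>2 \<le> (norm (\<xi> k - z))\<^sup>2"
      using fejer[OF that, of k] zero_le_power2[of "norm (\<eta> k - \<xi> k)"] by linarith
  qed simp
  have tri: "norm (\<xi> (Suc k) - z) \<le> norm (\<eta> k - z) + \<epsilon> k" for z k
    using norm_triangle_ineq[of "\<xi> (Suc k) - \<eta> k" "\<eta> k - z"] err[of k] by simp
  have conv: "convergent (\<lambda>k. norm (\<xi> k - z))" if "0 \<in> T z" for z
  proof (rule almost_decreasing_convergent[OF _ _ \<epsilon> \<epsilon>nn])
    show "norm (\<xi> (Suc k) - z) \<le> norm (\<xi> k - z) + \<epsilon> k" for k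
      using tri[of k z] \<eta>le[OF that, of k] by linarith
  qed simp
  obtain l where l: "(\<lambda>k. norm (\<xi> k - z0)) \<longlonglongrightarrow> l"
    using conv[OF z0] unfolding convergent_def by blast
  have step0: "(\<lambda>k. \<eta> k - \<xi> k) \<longlonglongrightarrow> 0"
  proof -
    have l2: "(\<lambda>k. norm (\<eta> k - z0)) \<longlonglongrightarrow> l"
    proof (rule tendsto_sandwich)
      show "(\<lambda>k. norm (\<xi> (Suc k) - z0) - \<epsilon> k) \<longlonglongrightarrow> l"
        using tendsto_diff[OF LIMSEQ_Suc[OF l] \<epsilon>0] by simp
      show "\<forall>\<^sub>F k in sequentially. norm (\<xi> (Suc k) - z0) - \<epsilon> k \<le> norm (\<eta> k - z0)"
        using tri[of _ z0] by (simp add: algebra_simps)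
      show "\<forall>\<^sub>F k in sequentially. norm (\<eta> k - z0) \<le> norm (\<xi> k - z0)"
        using \<eta>le[OF z0] by simp
    qed (rule l)
    have lim: "(\<lambda>k. (norm (\<xi> k - z0))\<^sup>2 - (norm (\<eta> k - z0))\<^sup>2) \<longlonglongrightarrow> 0"
      using tendsto_diff[OF tendsto_power[OF l, of 2] tendsto_power[OF l2, of 2]] by simp
    have "(\<lambda>k. (norm (\<eta> k - \<xi> k))\<^sup>2) \<longlonglongrightarrow> 0"
      by (rule tendsto_sandwich[OF _ _ tendsto_const lim])
        (use fejer[OF z0] in \<open>simp_all add: le_diff_eq add.commute\<close>)
    then have "(\<lambda>k. norm (\<eta> k - \<xi> k)) \<longlonglongrightarrow> 0" by simp
    then show ?thesis by (rule tendsto_norm_zero_cancel)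
  qed
  have v0: "(\<lambda>k. (1 / \<sigma> k) *\<^sub>R (\<xi> k - \<eta> k)) \<longlonglongrightarrow> 0"
  proof (rule Lim_null_comparison)
    show "\<forall>\<^sub>F k in sequentially. norm ((1 / \<sigma> k) *\<^sub>R (\<xi> k - \<eta> k)) \<le> 1 / s * norm (\<eta> k - \<xi> k)"
    proof (intro always_eventually allI)
      fix k
      have "1 / \<sigma> k \<le> 1 / s" using \<sigma>(1)[of k] \<sigma>(2) by (simp add: frac_le)
      then show "norm ((1 / \<sigma> k) *\<^sub>R (\<xi> k - \<eta> k)) \<le> 1 / s * norm (\<eta> k - \<xi> k)"
        unfolding norm_scaleR norm_minus_commute[of "\<xi> k"] using \<sigma>pos[of k]
        by (intro mult_right_mono) auto
    qed
    show "(\<lambda>k. 1 / s * norm (\<eta> k - \<xi> k)) \<longlonglongrightarrow> 0"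
      using tendsto_mult_right_zero[OF tendsto_norm_zero[OF step0]] by blast
  qed
  have "bounded (range \<xi>)"
  proof -
    have "bounded (range (\<lambda>k. \<xi> k - z0))"
      using convergent_imp_bounded[OF l] by (simp add: bounded_iff)
    from bounded_translation[OF this, of z0] show ?thesis by (simp add: image_image)
  qed
  then obtain xs r where r: "strict_mono (r::nat \<Rightarrow> nat)" and "(\<xi> \<circ> r) \<longlonglongrightarrow> xs"
    using bounded_imp_convergent_subsequence by blast
  then have \<xi>r: "(\<lambda>k. \<xi> (r k)) \<longlonglongrightarrow> xs" by (simp add: o_def)
  have \<eta>r: "(\<lambda>k. \<eta> (r k)) \<longlonglongrightarrow> xs"
    using tendsto_add[OF LIMSEQ_subseq_LIMSEQ[OF step0 r] \<xi>r] by (simp add: o_def)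
  have vr: "(\<lambda>k. (1 / \<sigma> (r k)) *\<^sub>R (\<xi> (r k) - \<eta> (r k))) \<longlonglongrightarrow> 0"
    using LIMSEQ_subseq_LIMSEQ[OF v0 r] by (simp add: o_def)
  have "(xs, 0) \<in> {(x, v). v \<in> T x}"
    by (rule closed_sequentially[OF cl _ tendsto_Pair[OF \<eta>r vr]]) (use step in auto)
  then have xs: "0 \<in> T xs" by simp
  obtain l' where l': "(\<lambda>k. norm (\<xi> k - xs)) \<longlonglongrightarrow> l'"
    using conv[OF xs] unfolding convergent_def by blast
  have "(\<lambda>k. norm (\<xi> (r k) - xs)) \<longlonglongrightarrow> 0"
    using \<xi>r by (intro tendsto_norm_zero) (simp add: LIM_zero_iff)
  with LIMSEQ_subseq_LIMSEQ[OF l' r] have "l' = 0"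
    by (auto simp: o_def intro: LIMSEQ_unique)
  with l' have \<xi>: "\<xi> \<longlonglongrightarrow> xs"
    by (simp add: tendsto_norm_zero_iff LIM_zero_iff)
  have "\<eta> \<longlonglongrightarrow> xs" using tendsto_add[OF step0 \<xi>] by simp
  with that \<xi> xs v0 show thesis by blast
qed

text \<open>Subregularity bounds the remaining distance by the step length, so that a short step is
  only possible close to the zeros; the square of a long step is lost from the squared distance in the
  Fejer estimate. Balancing both gives the factor.\<close>

lemma prox_step_contracts_infdist:
  assumes T: "monotone_operator T" and ne: "\<exists>z. 0 \<in> T z"
    and y: "(1 / \<sigma>) *\<^sub>R (x - y) \<in> T y" and \<sigma>: "0 < \<sigma>" and \<kappa>: "0 \<le> \<kappa>"
    and sub: "infdist y {z. 0 \<in> T z} \<le> \<kappa> * norm ((1 / \<sigma>) *\<^sub>R (x - y))"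
  shows "infdist y {z. 0 \<in> T z} \<le> \<kappa> * (\<kappa>\<^sup>2 + \<sigma>\<^sup>2) powr (- 1/2) * infdist x {z. 0 \<in> T z}"
    and "norm (y - x) \<le> infdist x {z. 0 \<in> T z}"
proof -
  let ?Z = "{z. 0 \<in> T z}" and ?d = "infdist y {z. 0 \<in> T z}"
  define q where "q = sqrt (\<kappa>\<^sup>2 + \<sigma>\<^sup>2)"
  have pos: "0 < \<kappa>\<^sup>2 + \<sigma>\<^sup>2" by (rule add_nonneg_pos) (use \<sigma> in simp_all)
  then have q2: "q\<^sup>2 = \<kappa>\<^sup>2 + \<sigma>\<^sup>2" and q: "0 < q" by (simp_all add: q_def)
  have powr: "(\<kappa>\<^sup>2 + \<sigma>\<^sup>2) powr (- 1/2) = 1 / q"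
    using powr_minus_divide[of "\<kappa>\<^sup>2 + \<sigma>\<^sup>2" "1/2"] powr_half_sqrt[of "\<kappa>\<^sup>2 + \<sigma>\<^sup>2"] pos
    by (simp add: q_def)
  have fejer: "(norm (y - z))\<^sup>2 + (norm (y - x))\<^sup>2 \<le> (norm (x - z))\<^sup>2" if "z \<in> ?Z" for z
    by (rule prox_step_fejer[OF T _ y \<sigma>]) (use that in auto)
  have "?d \<le> \<kappa> * (1 / q) * dist x z" if z: "z \<in> ?Z" for z
  proof -
    have d: "?d\<^sup>2 \<le> (norm (y - z))\<^sup>2"
      using infdist_le[OF z, of y] by (intro power_mono infdist_nonneg) (simp add: dist_norm)
    have "\<sigma> * ?d \<le> \<kappa> * norm (y - x)"
    proof -
      have "norm ((1 / \<sigma>) *\<^sub>R (x - y)) = norm (y - x) / \<sigma>"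
        unfolding norm_scaleR using \<sigma> by (simp add: norm_minus_commute)
      with sub have "?d \<le> \<kappa> * norm (y - x) / \<sigma>" by (simp only: times_divide_eq_right)
      then show ?thesis by (simp only: pos_le_divide_eq[OF \<sigma>] mult.commute[of ?d])
    qed
    then have "(\<sigma> * ?d)\<^sup>2 \<le> (\<kappa> * norm (y - x))\<^sup>2"
      by (rule power_mono) (use \<sigma> in \<open>simp add: infdist_nonneg\<close>)
    moreover have "\<kappa>\<^sup>2 * ?d\<^sup>2 \<le> \<kappa>\<^sup>2 * (norm (y - z))\<^sup>2"
      by (rule mult_left_mono[OF d]) simp
    moreover have "\<kappa>\<^sup>2 * ((norm (y - z))\<^sup>2 + (norm (y - x))\<^sup>2) \<le> \<kappa>\<^sup>2 * (norm (x - z))\<^sup>2"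
      by (rule mult_left_mono[OF fejer[OF z]]) simp
    ultimately have "(q * ?d)\<^sup>2 \<le> (\<kappa> * norm (x - z))\<^sup>2"
      unfolding power_mult_distrib q2 distrib_left distrib_right by linarith
    then have "q * ?d \<le> \<kappa> * norm (x - z)"
      by (rule power2_le_imp_le) (use \<kappa> in simp)
    then have "?d \<le> \<kappa> * norm (x - z) / q" by (simp only: pos_le_divide_eq[OF q] mult.commute[of ?d])
    then show ?thesis by (simp add: dist_norm)
  qed
  moreover have "?Z \<noteq> {}" "0 \<le> \<kappa> * (1 / q)" using ne \<kappa> q by simp_all
  ultimately show "?d \<le> \<kappa> * (\<kappa>\<^sup>2 + \<sigma>\<^sup>2) powr (- 1/2) * infdist x ?Z"
    unfolding powr by (intro le_mult_infdistI)
  have "norm (y - x) \<le> 1 * infdist x ?Z"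
  proof (rule le_mult_infdistI)
    fix z assume "z \<in> ?Z"
    from fejer[OF this] have "(norm (y - x))\<^sup>2 \<le> (norm (x - z))\<^sup>2"
      using zero_le_power2[of "norm (y - z)"] by linarith
    from power2_le_imp_le[OF this] show "norm (y - x) \<le> 1 * dist x z"
      by (simp add: dist_norm)
  qed (use ne in auto)
  then show "norm (y - x) \<le> infdist x ?Z" by simp
qed

text \<open>The exact step contracts the distance to the zeros. Its error is measured by the length of the
  computed step, which is at most \<open>1 / (1 - \<delta> k)\<close> times the length of the exact step; this is
  where the denominator of the factor comes from.\<close>

proposition inexact_proximal_point_rate:
  fixes \<xi> \<eta> :: "nat \<Rightarrow> 'a::euclidean_space"
  assumes T: "monotone_operator T" and sub: "metrically_subregular T xs 0 \<kappa>"
    and \<sigma>: "\<And>k. 0 < \<sigma> k"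
    and step: "\<And>k. (1 / \<sigma> k) *\<^sub>R (\<xi> k - \<eta> k) \<in> T (\<eta> k)"
    and \<eta>: "\<eta> \<longlonglongrightarrow> xs" and v0: "(\<lambda>k. (1 / \<sigma> k) *\<^sub>R (\<xi> k - \<eta> k)) \<longlonglongrightarrow> 0"
    and err: "\<And>k. norm (\<xi> (Suc k) - \<eta> k) \<le> \<delta> k * norm (\<xi> (Suc k) - \<xi> k)"
    and \<delta>: "\<And>k. 0 \<le> \<delta> k" "\<delta> \<longlonglongrightarrow> 0"
  shows "\<forall>\<^sub>F k in sequentially. infdist (\<xi> (Suc k)) {z. 0 \<in> T z}
    \<le> (\<kappa> * (\<kappa>\<^sup>2 + (\<sigma> k)\<^sup>2) powr (- 1/2) + \<delta> k) * inverse (1 - \<delta> k) * infdist (\<xi> k) {z. 0 \<in> T z}"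
proof -
  let ?Z = "{z. 0 \<in> T z}"
  from sub obtain U' V' where \<kappa>: "0 \<le> \<kappa>" and ne: "0 \<in> T xs"
    and nb: "open U'" "xs \<in> U'" "open V'" "0 \<in> V'"
    and reg: "\<And>x. x \<in> U' \<Longrightarrow> T x \<inter> V' \<noteq> {} \<Longrightarrow> infdist x ?Z \<le> \<kappa> * infdist 0 (T x \<inter> V')"
    unfolding metrically_subregular_def by blast
  have "\<forall>\<^sub>F k in sequentially. \<eta> k \<in> U'" using topological_tendstoD[OF \<eta>] nb by blast
  moreover have "\<forall>\<^sub>F k in sequentially. (1 / \<sigma> k) *\<^sub>R (\<xi> k - \<eta> k) \<in> V'"
    using topological_tendstoD[OF v0] nb by blast
  moreover have "\<forall>\<^sub>F k in sequentially. \<delta> k < 1" using order_tendstoD(2)[OF \<delta>(2)] by simp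
  ultimately show ?thesis
  proof eventually_elim
    case (elim k)
    let ?v = "(1 / \<sigma> k) *\<^sub>R (\<xi> k - \<eta> k)" and ?D = "infdist (\<xi> k) ?Z"
    define \<rho> where "\<rho> = \<kappa> * (\<kappa>\<^sup>2 + (\<sigma> k)\<^sup>2) powr (- 1/2)"
    have \<rho>: "0 \<le> \<rho>" using \<kappa> by (simp add: \<rho>_def)
    have v: "?v \<in> T (\<eta> k) \<inter> V'" using step elim by blast
    have "infdist (\<eta> k) ?Z \<le> \<kappa> * infdist 0 (T (\<eta> k) \<inter> V')" using reg[of "\<eta> k"] elim v by blast
    also have "\<dots> \<le> \<kappa> * norm ?v"
      using infdist_le[OF v, of 0] \<kappa> by (intro mult_left_mono) (auto simp: dist_norm)
    finally have *: "infdist (\<eta> k) ?Z \<le> \<kappa> * norm ?v" .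
    have "\<exists>z. 0 \<in> T z" using ne by blast
    note contr = prox_step_contracts_infdist[OF T this step \<sigma> \<kappa> *, folded \<rho>_def]
    let ?e = "norm (\<xi> (Suc k) - \<xi> k)"
    have "?e \<le> norm (\<xi> (Suc k) - \<eta> k) + norm (\<eta> k - \<xi> k)"
      using norm_triangle_ineq[of "\<xi> (Suc k) - \<eta> k" "\<eta> k - \<xi> k"] by simp
    then have "(1 - \<delta> k) * ?e \<le> ?D" using err[of k] contr(2) by (simp add: algebra_simps)
    then have e: "?e \<le> ?D * inverse (1 - \<delta> k)" using elim by (simp add: field_simps)
    have "infdist (\<xi> (Suc k)) ?Z \<le> infdist (\<eta> k) ?Z + norm (\<xi> (Suc k) - \<eta> k)"
      using infdist_triangle[of "\<xi> (Suc k)" ?Z "\<eta> k"] by (simp add: dist_norm)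
    also have "\<dots> \<le> \<rho> * ?D + \<delta> k * (?D * inverse (1 - \<delta> k))"
      using contr(1) err[of k] mult_left_mono[OF e \<delta>(1)[of k]] by linarith
    also have "\<dots> \<le> \<rho> * inverse (1 - \<delta> k) * ?D + \<delta> k * (?D * inverse (1 - \<delta> k))"
    proof -
      have "1 \<le> inverse (1 - \<delta> k)" using elim \<delta>(1)[of k] by (simp add: one_le_inverse_iff)
      then have "\<rho> * 1 \<le> \<rho> * inverse (1 - \<delta> k)" by (intro mult_left_mono \<rho>)
      from mult_right_mono[OF this infdist_nonneg[of "\<xi> k" ?Z]] show ?thesis by simp
    qed
    finally show ?case unfolding \<rho>_def[symmetric] by (simp add: algebra_simps)
  qed
qed


section \<open>Products of balls and their support functions\<close>

lemma norm_inf_le_iff: "norm_inf (z :: ('a::real_normed_vector) ^ 'p) \<le> c \<longleftrightarrow> (\<forall>i. norm (z $ i) \<le> c)"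
  unfolding norm_inf_def by (subst Max_le_iff) auto

lemma convex_norm_components_le: "convex {z :: ('a::real_normed_vector) ^ 'p. \<forall>i. norm (z $ i) \<le> c}"
proof -
  have "{z :: 'a ^ 'p. \<forall>i. norm (z $ i) \<le> c} = (\<Inter>i. (\<lambda>z. z $ i) -` cball 0 c)" by auto
  also have "convex \<dots>"
    by (intro convex_INT convex_linear_vimage linearI convex_cball) simp_all
  finally show ?thesis .
qed

lemma norm_le_norm1: "norm (z :: ('a::real_normed_vector) ^ 'p) \<le> norm1 z"
  by (simp add: norm_vec_def norm1_def L2_set_le_sum)

lemma norm1_scaleR: "norm1 (c *\<^sub>R z) = \<bar>c\<bar> * norm1 z"
  by (simp add: norm1_def sum_distrib_left)

lemma continuous_on_norm1 [continuous_intros]: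
  fixes f :: "'b::topological_space \<Rightarrow> ('a::real_normed_vector) ^ 'p"
  shows "continuous_on S f \<Longrightarrow> continuous_on S (\<lambda>x. norm1 (f x))"
  unfolding norm1_def
  by (intro continuous_intros) (auto intro: continuous_on_compose2 continuous_on_component)

lemma inner_le_norm1:
  fixes l h :: "('a::real_inner) ^ 'p"
  assumes "\<And>i. norm (l $ i) \<le> \<alpha>"
  shows "l \<bullet> h \<le> \<alpha> * norm1 h"
  unfolding inner_vec_def norm1_def sum_distrib_left
proof (rule sum_mono)
  fix i
  show "l $ i \<bullet> h $ i \<le> \<alpha> * norm (h $ i)"
    using norm_cauchy_schwarz[of "l $ i" "h $ i"] mult_right_mono[OF assms[of i], of "norm (h $ i)"]
    by simp
qed

lemma norm1_attained:
  fixes h :: "('a::real_inner) ^ 'p"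
  assumes "0 \<le> \<alpha>"
  obtains l where "\<And>i. norm (l $ i) \<le> \<alpha>" "l \<bullet> h = \<alpha> * norm1 h"
proof
  let ?l = "(\<chi> i. \<alpha> *\<^sub>R sgn (h $ i)) :: 'a ^ 'p"
  show "norm (?l $ i) \<le> \<alpha>" for i using assms by (simp add: norm_sgn)
  have "sgn x \<bullet> x = norm x" for x :: 'a
    by (cases "x = 0") (simp_all add: sgn_div_norm power2_norm_eq_inner[symmetric] power2_eq_square)
  then show "?l \<bullet> h = \<alpha> * norm1 h"
    by (simp add: inner_vec_def norm1_def sum_distrib_left)
qed

text \<open>A sum of Cauchy-Schwarz inequalities is an equality only if each of them is. This turns the
  optimality condition, stated with support functions, into a condition at each pixel.\<close>

lemma norm1_attained_pointwise:
  fixes l h :: "('a::real_inner) ^ 'p"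
  assumes ball: "\<And>i. norm (l $ i) \<le> \<alpha>" and le: "\<alpha> * norm1 h \<le> l \<bullet> h"
  shows "l $ i \<bullet> h $ i = \<alpha> * norm (h $ i)"
proof -
  let ?g = "\<lambda>i. \<alpha> * norm (h $ i) - l $ i \<bullet> h $ i"
  have nn: "0 \<le> ?g i" for i
    using norm_cauchy_schwarz[of "l $ i" "h $ i"] mult_right_mono[OF ball[of i], of "norm (h $ i)"]
    by simp
  have "sum ?g UNIV \<le> 0"
    using le by (simp add: inner_vec_def norm1_def sum_distrib_left sum_subtractf)
  then have "sum ?g UNIV = 0" using sum_nonneg[of UNIV ?g] nn by force
  then have "?g i = 0" using sum_nonneg_eq_0_iff[of UNIV ?g] nn by simp
  then show ?thesis by simp
qed

lemma proj_ball_norm_le: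
  assumes "0 < \<alpha>" shows "norm (proj_ball \<alpha> z $ i) \<le> \<alpha>"
proof -
  let ?m = "max 1 (norm (z $ i) / \<alpha>)"
  have "norm (z $ i) / \<alpha> \<le> ?m" by simp
  then have "norm (z $ i) \<le> \<alpha> * ?m" by (simp only: pos_divide_le_eq[OF assms] mult.commute[of _ \<alpha>])
  moreover have "0 < ?m" by (simp add: less_max_iff_disj)
  ultimately have "norm (z $ i) / ?m \<le> \<alpha>" by (simp only: pos_divide_le_eq)
  moreover have "norm (proj_ball \<alpha> z $ i) = norm (z $ i) / ?m"
    by (simp add: proj_ball_def divide_inverse mult.commute)
  ultimately show ?thesis by simp
qed

text \<open>The residual of the projection onto a ball is an outer normal at the projected point.\<close>

lemma proj_ball_normal:
  fixes z :: "('a::real_inner) ^ 'p"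
  assumes \<alpha>: "0 < \<alpha>"
  shows "\<alpha> * norm1 (z - proj_ball \<alpha> z) = proj_ball \<alpha> z \<bullet> (z - proj_ball \<alpha> z)"
  unfolding inner_vec_def norm1_def sum_distrib_left
proof (rule sum.cong[OF refl])
  fix i
  let ?z = "z $ i"
  define t where "t = 1 / max 1 (norm ?z / \<alpha>)"
  have P: "proj_ball \<alpha> z $ i = t *\<^sub>R ?z"
    by (simp add: proj_ball_def t_def divide_inverse)
  have t1: "t \<le> 1" by (simp add: t_def le_max_iff_disj)
  have d: "?z - t *\<^sub>R ?z = (1 - t) *\<^sub>R ?z" by (simp add: scaleR_left_diff_distrib)
  have "t = 1 \<or> t * norm ?z = \<alpha>"
  proof (cases "norm ?z / \<alpha> \<le> 1")
    case False
    then have "t = \<alpha> / norm ?z" "norm ?z \<noteq> 0" using \<alpha> by (auto simp: t_def max_def)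
    then show ?thesis by simp
  qed (simp add: t_def max_def)
  then have "\<alpha> * ((1 - t) * norm ?z) = t * ((1 - t) * (norm ?z * norm ?z))"
    by auto
  then show "\<alpha> * norm ((z - proj_ball \<alpha> z) $ i) = proj_ball \<alpha> z $ i \<bullet> (z - proj_ball \<alpha> z) $ i"
    using t1 by (simp add: P d power2_norm_eq_inner[symmetric] power2_eq_square)
qed

text \<open>A ball is curved: leaving the point where a linear functional attains its maximum over the
  ball costs an amount quadratic in the distance. Where the normal \<open>h\<close> of the optimality condition
  is nonzero, this supplies the growth that the quadratic part of the dual lacks.\<close>

lemma cball_quadratic_growth:
  fixes x y h :: "'a::real_inner"
  assumes \<alpha>: "0 < \<alpha>" and x: "norm x \<le> \<alpha>" and y: "norm y \<le> \<alpha>" and h: "y \<bullet> h = \<alpha> * norm h"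
  shows "norm h / (2 * \<alpha>) * (norm (x - y))\<^sup>2 \<le> h \<bullet> (y - x)"
proof -
  have y2: "y \<bullet> y \<le> \<alpha>\<^sup>2" and x2: "x \<bullet> x \<le> \<alpha>\<^sup>2"
    using power_mono[OF y, of 2] power_mono[OF x, of 2] by (simp_all add: power2_norm_eq_inner)
  have "(norm (c *\<^sub>R y - d *\<^sub>R h))\<^sup>2 = c\<^sup>2 * (y \<bullet> y) - 2 * (c * d * (y \<bullet> h)) + d\<^sup>2 * (h \<bullet> h)" for c d
    unfolding power2_norm_eq_inner
    by (simp add: inner_diff_left inner_diff_right inner_commute[of h y]
        power2_eq_square algebra_simps)
  from this[of "norm h" \<alpha>] have "(norm (norm h *\<^sub>R y - \<alpha> *\<^sub>R h))\<^sup>2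
      = (norm h)\<^sup>2 * (y \<bullet> y) - 2 * (norm h * \<alpha> * (y \<bullet> h)) + \<alpha>\<^sup>2 * (norm h)\<^sup>2"
    by (simp add: power2_norm_eq_inner)
  also have "\<dots> = (norm h)\<^sup>2 * (y \<bullet> y - \<alpha>\<^sup>2)" by (simp add: h power2_eq_square algebra_simps)
  also have "\<dots> \<le> 0" using y2 by (simp add: mult_nonneg_nonpos)
  finally have hy: "norm h *\<^sub>R y = \<alpha> *\<^sub>R h" by simp
  have "norm h * (norm (x - y))\<^sup>2 = norm h * (x \<bullet> x) + norm h * (y \<bullet> y) - 2 * ((norm h *\<^sub>R y) \<bullet> x)"
    by (simp add: power2_norm_eq_inner inner_diff_left inner_diff_right inner_commute algebra_simps)
  also have "\<dots> \<le> norm h * \<alpha>\<^sup>2 + norm h * \<alpha>\<^sup>2 - 2 * (\<alpha> * (h \<bullet> x))"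
    using mult_left_mono[OF x2 norm_ge_zero[of h]] mult_left_mono[OF y2 norm_ge_zero[of h]]
    by (simp add: hy)
  also have "\<dots> = 2 * \<alpha> * (h \<bullet> (y - x))"
    using h by (simp add: inner_diff_right inner_commute power2_eq_square algebra_simps)
  finally show ?thesis using \<alpha> by (simp add: field_simps)
qed

lemma quadratic_form_coercive_on_subspace:
  fixes q :: "'a::euclidean_space \<Rightarrow> real"
  assumes cont: "continuous_on UNIV q" and hom: "\<And>t x. q (t *\<^sub>R x) = t\<^sup>2 * q x"
    and S: "subspace S" and pos: "\<And>x. x \<in> S \<Longrightarrow> x \<noteq> 0 \<Longrightarrow> 0 < q x"
  obtains c where "0 < c" "\<And>x. x \<in> S \<Longrightarrow> c * (norm x)\<^sup>2 \<le> q x"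
proof (cases "S \<inter> sphere 0 1 = {}")
  case True
  have "x = 0" if "x \<in> S" for x
  proof (rule ccontr)
    assume "x \<noteq> 0"
    then have "(1 / norm x) *\<^sub>R x \<in> S \<inter> sphere 0 1"
      using subspace_scale[OF S that] by simp
    with True show False by blast
  qed
  moreover have "q 0 = 0" using hom[of 0 0] by simp
  ultimately have "1 * (norm x)\<^sup>2 \<le> q x" if "x \<in> S" for x using that by fastforce
  then show ?thesis using that[of 1] by simp
next
  case False
  have "compact (S \<inter> sphere 0 1)"
    by (intro closed_Int_compact closed_subspace S compact_sphere)
  then obtain z where z: "z \<in> S \<inter> sphere 0 1" and min: "\<And>x. x \<in> S \<inter> sphere 0 1 \<Longrightarrow> q z \<le> q x"
    using continuous_attains_inf[OF _ False continuous_on_subset[OF cont subset_UNIV]] by blast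
  have "q z * (norm x)\<^sup>2 \<le> q x" if x: "x \<in> S" for x
  proof (cases "x = 0")
    case True
    then show ?thesis using hom[of 0 0] by simp
  next
    case False
    then have "(1 / norm x) *\<^sub>R x \<in> S \<inter> sphere 0 1"
      using subspace_scale[OF S x] by simp
    from mult_right_mono[OF min[OF this], of "(norm x)\<^sup>2"] False
    show ?thesis by (simp add: hom power_one_over)
  qed
  moreover have "0 < q z" using z pos[of z] by fastforce
  ultimately show ?thesis using that by blast
qed

lemma GDERIV_unique:
  assumes "GDERIV f x :> D" "GDERIV f x :> D'"
  shows "D = D'"
proof -
  have "(\<lambda>h. h \<bullet> D) = (\<lambda>h. h \<bullet> D')"
    using assms unfolding gderiv_def by (rule has_derivative_unique)
  then show ?thesis by (metis vector_eq_ldot)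
qed

lemma GDERIV_of_quadratic_remainder:
  fixes f q :: "'a::euclidean_space \<Rightarrow> real"
  assumes exp: "\<And>h. f (x + h) = f x + D \<bullet> h + q h"
    and cont: "continuous_on UNIV q" and hom: "\<And>t h. q (t *\<^sub>R h) = t\<^sup>2 * q h"
  shows "GDERIV f x :> D"
proof -
  have "bounded (q ` sphere 0 1)"
    by (intro compact_imp_bounded compact_continuous_image continuous_on_subset[OF cont] compact_sphere) simp
  then obtain c where c: "\<And>h. norm h = 1 \<Longrightarrow> \<bar>q h\<bar> \<le> c" by (fastforce simp: bounded_iff)
  have q: "\<bar>q h\<bar> / norm h \<le> c * norm h" if "h \<noteq> 0" for h
  proof -
    have "q h = q (norm h *\<^sub>R ((1 / norm h) *\<^sub>R h))" using that by simp
    also have "\<dots> = (norm h)\<^sup>2 * q ((1 / norm h) *\<^sub>R h)" by (rule hom)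
    finally have "\<bar>q h\<bar> = (norm h)\<^sup>2 * \<bar>q ((1 / norm h) *\<^sub>R h)\<bar>" by (simp add: abs_mult)
    also have "\<dots> \<le> (norm h)\<^sup>2 * c" using that by (intro mult_left_mono c) simp_all
    finally show ?thesis using that by (simp add: pos_divide_le_eq power2_eq_square mult_ac)
  qed
  show ?thesis
    unfolding gderiv_def has_derivative_at
  proof
    show "bounded_linear (\<lambda>h. h \<bullet> D)" by (rule bounded_linear_inner_left)
    show "(\<lambda>h. norm (f (x + h) - f x - h \<bullet> D) / norm h) \<midarrow>0\<rightarrow> 0"
    proof (rule Lim_null_comparison)
      show "\<forall>\<^sub>F h in at 0. norm (norm (f (x + h) - f x - h \<bullet> D) / norm h) \<le> c * norm h"
        using q by (simp add: eventually_at_filter exp inner_commute)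
      show "((\<lambda>h. c * norm h) \<longlongrightarrow> 0) (at 0)"
        by (intro tendsto_mult_right_zero tendsto_norm_zero tendsto_ident_at)
    qed
  qed
qed


section \<open>Linearity of the difference operators\<close>

lemma linear_dx: "linear dx" and linear_dy: "linear dy"
  by (auto intro!: linearI simp: dx_def dy_def vec_eq_iff algebra_simps)

lemma linear_component: "linear (component l)"
  by (auto intro!: linearI simp: component_def vec_eq_iff)

lemma linear_grad: "linear grad"
  by (auto intro!: linearI simp: grad_def vec_eq_iff forall_2 linear_add[OF linear_dx]
      linear_add[OF linear_dy] linear_cmul[OF linear_dx] linear_cmul[OF linear_dy])

lemma linear_symgrad: "linear symgrad"
  by (auto intro!: linearI simp: symgrad_def vec_eq_iff sym2_eq_iff linear_add[OF linear_dx]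
      linear_add[OF linear_dy] linear_cmul[OF linear_dx] linear_cmul[OF linear_dy]
      linear_add[OF linear_component] linear_cmul[OF linear_component] algebra_simps)


section \<open>The dual problem\<close>

locale tgv_problem =
  fixes K :: "('i::{finite,linorder}, 'j::{finite,linorder}) U \<Rightarrow> ('i, 'j) U"
    and f0 :: "('i, 'j) U" and \<nu> a \<alpha>0 \<alpha>1 :: real
  assumes linear_K: "linear K" and a_pos: "0 < a" and \<alpha>0_pos: "0 < \<alpha>0" and \<alpha>1_pos: "0 < \<alpha>1"
    and H_pd: "positive_definite (H_op K \<nu>)"
begin

abbreviation "H \<equiv> H_op K \<nu>"
abbreviation "R \<equiv> inv H"
abbreviation "f \<equiv> adjoint K f0"
abbreviation gradT :: "('i, 'j) V \<Rightarrow> ('i, 'j) U" where "gradT \<equiv> adjoint grad"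
abbreviation symgradT :: "('i, 'j) W \<Rightarrow> ('i, 'j) V" where "symgradT \<equiv> adjoint symgrad"

lemmas linear_gradT = adjoint_linear[OF linear_grad]
lemmas linear_symgradT = adjoint_linear[OF linear_symgrad]

lemma inner_gradT: "gradT l \<bullet> u = l \<bullet> grad u" "u \<bullet> gradT l = l \<bullet> grad u"
  using adjoint_works[OF linear_grad, of u l] by (simp_all add: inner_commute)

lemma inner_symgradT: "symgradT m \<bullet> w = m \<bullet> symgrad w" "w \<bullet> symgradT m = m \<bullet> symgrad w"
  using adjoint_works[OF linear_symgrad, of w m] by (simp_all add: inner_commute)

lemma H_eq: "H u = adjoint K (K u) + \<nu> *\<^sub>R gradT (grad u)"
  by (simp add: H_op_def laplace_def dvg_def)

lemma linear_H: "linear H"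
  unfolding H_eq[abs_def]
  by (intro linear_compose_add linear_compose_scale_right linear_compose[unfolded o_def, OF linear_K]
      linear_compose[unfolded o_def, OF linear_grad] adjoint_linear linear_K linear_grad)

lemma inner_H: "H u \<bullet> v = K u \<bullet> K v + \<nu> * (grad u \<bullet> grad v)"
  using adjoint_works[OF linear_K, of v "K u"]
  by (simp add: H_eq inner_add_left inner_gradT) (simp add: inner_commute)

lemma H_sym: "H u \<bullet> v = u \<bullet> H v"
  by (simp add: inner_H inner_commute[of u]) (simp add: inner_commute)

lemma H_pos: "x \<noteq> 0 \<Longrightarrow> 0 < H x \<bullet> x"
  using H_pd unfolding positive_definite_def by blast

lemma inj_H: "inj H"
proof (rule linear_injective_0[OF linear_H, THEN iffD2], intro allI impI)
  fix x assume "H x = 0"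
  then show "x = 0" using H_pos[of x] by fastforce
qed

lemma H_R [simp]: "H (R v) = v"
  using linear_inj_imp_surj[OF linear_H inj_H] by (rule surj_f_inv_f)

lemma R_H [simp]: "R (H u) = u"
  by (rule inv_f_f[OF inj_H])

lemma linear_R: "linear R"
proof (rule linearI)
  fix x y and c :: real
  have "R (H (R x + R y)) = R x + R y" "R (H (c *\<^sub>R R x)) = c *\<^sub>R R x" by simp_all
  then show "R (x + y) = R x + R y" "R (c *\<^sub>R x) = c *\<^sub>R R x"
    by (simp_all only: linear_add[OF linear_H] linear_cmul[OF linear_H] H_R)
qed

lemma R_sym: "R x \<bullet> y = x \<bullet> R y"
  using H_sym[of "R x" "R y"] by simp

lemma R_nonneg: "0 \<le> R x \<bullet> x" and R_zero_iff: "R x \<bullet> x = 0 \<longleftrightarrow> x = 0"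
proof -
  have eq: "R x \<bullet> x = H (R x) \<bullet> R x" by (simp add: inner_commute)
  have "R x \<noteq> 0" if "x \<noteq> 0" using that H_R[of x] linear_0[OF linear_H] by metis
  then have "0 < R x \<bullet> x" if "x \<noteq> 0" unfolding eq using that H_pos by blast
  then show "0 \<le> R x \<bullet> x" "R x \<bullet> x = 0 \<longleftrightarrow> x = 0"
    by (cases "x = 0"; force)+
qed

lemmas ops_simps =
  linear_R[THEN linear_add] linear_R[THEN linear_diff] linear_R[THEN linear_cmul] linear_R[THEN linear_0]
  linear_gradT[THEN linear_add] linear_gradT[THEN linear_diff] linear_gradT[THEN linear_cmul]
  linear_gradT[THEN linear_0]
  linear_symgradT[THEN linear_add] linear_symgradT[THEN linear_diff] linear_symgradT[THEN linear_cmul]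
  linear_symgradT[THEN linear_0]
  linear_grad[THEN linear_add] linear_grad[THEN linear_diff] linear_grad[THEN linear_cmul]
  linear_grad[THEN linear_0]
  linear_symgrad[THEN linear_add] linear_symgrad[THEN linear_diff] linear_symgrad[THEN linear_cmul]
  linear_symgrad[THEN linear_0]

lemmas continuous_ops [continuous_intros] =
  linear_continuous_on_compose[OF _ linear_R] linear_continuous_on_compose[OF _ linear_gradT]
  linear_continuous_on_compose[OF _ linear_symgradT] linear_continuous_on_compose[OF _ linear_grad]
  linear_continuous_on_compose[OF _ linear_symgrad]

text \<open>The pair \<open>(u, w)\<close> that solves the two linear equations of the optimality system for given
  multipliers.\<close>

definition primal_u :: "('i, 'j) V \<times> ('i, 'j) W \<Rightarrow> ('i, 'j) U" where
  "primal_u \<xi> = R (f - gradT (fst \<xi>))"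

definition primal_w :: "('i, 'j) V \<times> ('i, 'j) W \<Rightarrow> ('i, 'j) V" where
  "primal_w \<xi> = (1 / a) *\<^sub>R (fst \<xi> - symgradT (snd \<xi>))"

text \<open>Minus the gradient of the smooth part of the dual function. It equals the constraint residual
  \<open>(grad u - w, symgrad w)\<close> of the primal pair that belongs to \<open>\<xi>\<close>, before the split variables
  \<open>h1\<close>, \<open>h2\<close> are subtracted.\<close>

definition descent :: "('i, 'j) V \<times> ('i, 'j) W \<Rightarrow> ('i, 'j) V \<times> ('i, 'j) W" where
  "descent \<xi> = (grad (primal_u \<xi>) - primal_w \<xi>, symgrad (primal_w \<xi>))"

text \<open>The Hessian form of the smooth part of the dual function.\<close>

definition curvature :: "('i, 'j) V \<times> ('i, 'j) W \<Rightarrow> real" where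
  "curvature \<eta> = R (gradT (fst \<eta>)) \<bullet> gradT (fst \<eta>) + 1 / a * (norm (fst \<eta> - symgradT (snd \<eta>)))\<^sup>2"

text \<open>The support function of the product of balls below.\<close>

definition support :: "('i, 'j) V \<times> ('i, 'j) W \<Rightarrow> real" where
  "support n = \<alpha>1 * norm1 (fst n) + \<alpha>0 * norm1 (snd n)"

definition balls :: "(('i, 'j) V \<times> ('i, 'j) W) set" where
  "balls = {\<xi>. (\<forall>i. norm (fst \<xi> $ i) \<le> \<alpha>1) \<and> (\<forall>i. norm (snd \<xi> $ i) \<le> \<alpha>0)}"

lemma ballsD: assumes "\<xi> \<in> balls" shows "norm (fst \<xi> $ i) \<le> \<alpha>1" "norm (snd \<xi> $ i) \<le> \<alpha>0"
  using assms unfolding balls_def by blast+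

abbreviation "Ds \<equiv> dual_smooth K f0 \<nu> a"
abbreviation "T \<equiv> subdifferential (dual_fun K f0 \<nu> a \<alpha>0 \<alpha>1)"

lemma curvature_nonneg: "0 \<le> curvature \<eta>"
  unfolding curvature_def using R_nonneg a_pos by simp

lemma continuous_on_curvature: "continuous_on S curvature"
  unfolding curvature_def[abs_def] by (intro continuous_intros)

lemma continuous_on_descent: "continuous_on S descent"
  unfolding descent_def[abs_def] primal_u_def[abs_def] primal_w_def[abs_def]
  by (intro continuous_intros)

lemma continuous_on_support: "continuous_on S support"
  unfolding support_def[abs_def] by (intro continuous_intros)

lemma curvature_scaleR: "curvature (t *\<^sub>R \<eta>) = t\<^sup>2 * curvature \<eta>"
  unfolding curvature_def
  by (simp add: ops_simps scaleR_diff_right[symmetric] power_mult_distrib)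
     (simp add: power2_eq_square algebra_simps)

lemma dual_smooth_expansion: "Ds (\<xi> + \<eta>) = Ds \<xi> - descent \<xi> \<bullet> \<eta> + curvature \<eta> / 2"
proof -
  obtain l m where \<xi>: "\<xi> = (l, m)" by (cases \<xi>)
  obtain dl dm where \<eta>: "\<eta> = (dl, dm)" by (cases \<eta>)
  define v where "v = f - gradT l"
  define e where "e = l - symgradT m"
  define d where "d = dl - symgradT dm"
  have R: "R (v - gradT dl) \<bullet> (v - gradT dl)
      = R v \<bullet> v - 2 * (grad (R v) \<bullet> dl) + R (gradT dl) \<bullet> gradT dl"
    using R_sym[of "gradT dl" v]
    by (simp add: ops_simps inner_diff_left inner_diff_right inner_gradT inner_commute)
  have n: "(norm (e + d))\<^sup>2 = (norm e)\<^sup>2 + 2 * (e \<bullet> dl - symgrad e \<bullet> dm) + (norm d)\<^sup>2"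
    unfolding power2_norm_eq_inner
    by (simp add: inner_add_left inner_add_right inner_commute[of d e])
       (simp add: d_def inner_diff_left inner_diff_right inner_symgradT inner_commute)
  have args: "dvg (l + dl) + f = v - gradT dl" "dvg l + f = v"
    "l + dl - symgradT (m + dm) = e + d"
    by (simp_all add: dvg_def v_def e_def d_def ops_simps)
  have "Ds (\<xi> + \<eta>) = 1/2 * (R v \<bullet> v - 2 * (grad (R v) \<bullet> dl) + R (gradT dl) \<bullet> gradT dl)
      - 1/2 * (norm f0)\<^sup>2
      + 1 / (2 * a) * ((norm e)\<^sup>2 + 2 * (e \<bullet> dl - symgrad e \<bullet> dm) + (norm d)\<^sup>2)"
    by (simp only: \<xi> \<eta> dual_smooth_def add_Pair prod.case args R n)
  moreover have "Ds \<xi> = 1/2 * (R v \<bullet> v) - 1/2 * (norm f0)\<^sup>2 + 1 / (2 * a) * (norm e)\<^sup>2"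
    by (simp only: \<xi> dual_smooth_def prod.case args e_def)
  moreover have "descent \<xi> \<bullet> \<eta> = grad (R v) \<bullet> dl - 1 / a * (e \<bullet> dl) + 1 / a * (symgrad e \<bullet> dm)"
    by (simp add: \<xi> \<eta> descent_def primal_u_def primal_w_def v_def[symmetric] e_def[symmetric]
        inner_diff_left linear_cmul[OF linear_symgrad])
  moreover have "curvature \<eta> = R (gradT dl) \<bullet> gradT dl + 1 / a * (norm d)\<^sup>2"
    by (simp add: \<eta> curvature_def d_def)
  ultimately show ?thesis by (simp add: algebra_simps add_divide_distrib)
qed

corollary dual_smooth_expansion': "Ds \<zeta> = Ds \<xi> - descent \<xi> \<bullet> (\<zeta> - \<xi>) + curvature (\<zeta> - \<xi>) / 2"
  using dual_smooth_expansion[of \<xi> "\<zeta> - \<xi>"] by simp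

lemma inner_le_support: "\<xi> \<in> balls \<Longrightarrow> \<xi> \<bullet> n \<le> support n"
  unfolding balls_def support_def inner_prod_def by (intro add_mono inner_le_norm1) auto

lemma support_attained: obtains \<zeta> where "\<zeta> \<in> balls" "\<zeta> \<bullet> n = support n"
proof -
  obtain l where "\<And>i. norm (l $ i) \<le> \<alpha>1" "l \<bullet> fst n = \<alpha>1 * norm1 (fst n)"
    using norm1_attained[of \<alpha>1 "fst n"] \<alpha>1_pos by auto
  moreover obtain m where "\<And>i. norm (m $ i) \<le> \<alpha>0" "m \<bullet> snd n = \<alpha>0 * norm1 (snd n)"
    using norm1_attained[of \<alpha>0 "snd n"] \<alpha>0_pos by auto
  ultimately show thesis by (intro that[of "(l, m)"]) (simp_all add: balls_def support_def inner_prod_def)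
qed

lemma convex_balls: "convex balls"
proof -
  have "balls = {z. \<forall>i. norm (z $ i) \<le> \<alpha>1} \<times> {z. \<forall>i. norm (z $ i) \<le> \<alpha>0}"
    by (auto simp: balls_def)
  then show ?thesis by (simp only: convex_Times convex_norm_components_le)
qed

lemma closed_balls: "closed balls"
  unfolding balls_def
  by (intro closed_Collect_conj closed_Collect_all closed_Collect_le continuous_intros)

lemma compact_balls: "compact balls"
proof -
  have "norm \<xi> \<le> CARD('i \<times> 'j) * \<alpha>1 + CARD('i \<times> 'j) * \<alpha>0" if "\<xi> \<in> balls" for \<xi>
  proof -
    have "norm1 (fst \<xi>) \<le> CARD('i \<times> 'j) * \<alpha>1" "norm1 (snd \<xi>) \<le> CARD('i \<times> 'j) * \<alpha>0"
      unfolding norm1_def using that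
      by (auto simp only: balls_def mem_Collect_eq intro!: sum_bounded_above)
    then show ?thesis
      using norm_le_norm1[of "fst \<xi>"] norm_le_norm1[of "snd \<xi>"] norm_Pair_le[of "fst \<xi>" "snd \<xi>"]
      by simp
  qed
  then have "bounded balls" unfolding bounded_iff by blast
  with closed_balls show ?thesis by (simp add: compact_eq_bounded_closed)
qed

lemma zero_in_balls: "0 \<in> balls"
  using \<alpha>0_pos \<alpha>1_pos by (simp add: balls_def)

lemma dual_fun_eq: "dual_fun K f0 \<nu> a \<alpha>0 \<alpha>1 \<xi> = (if \<xi> \<in> balls then ereal (Ds \<xi>) else \<infinity>)"
  by (cases \<xi>) (auto simp: dual_fun_def indicator_fun_def balls_def norm_inf_le_iff)

lemma dual_solutions_eq: "dual_solutions K f0 \<nu> a \<alpha>0 \<alpha>1 = {\<xi>. 0 \<in> T \<xi>}"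
proof -
  have "\<xi> \<in> balls" if "\<And>y. dual_fun K f0 \<nu> a \<alpha>0 \<alpha>1 \<xi> \<le> dual_fun K f0 \<nu> a \<alpha>0 \<alpha>1 y" for \<xi>
    using that[of 0] zero_in_balls by (simp add: dual_fun_eq split: if_splits)
  then show ?thesis
    unfolding dual_solutions_def subdifferential_def
    by (auto simp: ereal_minus_le_minus zero_ereal_def[symmetric] dual_fun_eq)
qed

lemma subdifferential_dual_iff:
  "v \<in> T \<xi> \<longleftrightarrow> \<xi> \<in> balls \<and> (\<forall>\<zeta>\<in>balls. Ds \<xi> + v \<bullet> (\<zeta> - \<xi>) \<le> Ds \<zeta>)"
  by (auto simp: subdifferential_def dual_fun_eq)

lemma monotone_subdifferential_dual: "monotone_operator T"
  unfolding monotone_operator_def subdifferential_dual_iff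
proof (intro allI ballI)
  fix x y v w
  assume "v \<in> T x" "w \<in> T y"
  then have "Ds x + v \<bullet> (y - x) \<le> Ds y" "Ds y + w \<bullet> (x - y) \<le> Ds x"
    unfolding subdifferential_dual_iff by auto
  then show "0 \<le> (v - w) \<bullet> (x - y)"
    by (simp add: inner_diff_left inner_diff_right)
qed

text \<open>The sum rule \<open>T \<xi> = - descent \<xi> + N \<xi>\<close>, with \<open>N\<close> the normal cone of the product of balls.
  Normality of \<open>n\<close> at \<open>\<xi>\<close> is expressed as \<open>support n \<le> \<xi> \<bullet> n\<close>, a single inequality that is
  continuous in both arguments; the closed graph of \<open>T\<close> follows from this form. The normality of
  \<open>v + descent \<xi>\<close> results from comparing \<open>\<xi>\<close> with points on the segment towards a maximizer of
  the functional and letting them tend to \<open>\<xi>\<close>.\<close>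

lemma subdifferential_dual_normal_iff:
  "v \<in> T \<xi> \<longleftrightarrow> \<xi> \<in> balls \<and> support (v + descent \<xi>) \<le> \<xi> \<bullet> (v + descent \<xi>)"
proof (intro iffI conjI)
  assume v: "v \<in> T \<xi>"
  then show \<xi>: "\<xi> \<in> balls" by (simp add: subdifferential_dual_iff)
  let ?n = "v + descent \<xi>"
  obtain \<zeta> where \<zeta>: "\<zeta> \<in> balls" "\<zeta> \<bullet> ?n = support ?n" by (rule support_attained)
  define x where "x = ?n \<bullet> (\<zeta> - \<xi>)"
  define c where "c = curvature (\<zeta> - \<xi>) / 2"
  have c: "0 \<le> c" using curvature_nonneg by (simp add: c_def)
  have t: "x \<le> t * c" if "0 < t" "t \<le> 1" for t
  proof -
    have "\<xi> + t *\<^sub>R (\<zeta> - \<xi>) \<in> balls"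
      using convexD_alt[OF convex_balls \<xi> \<zeta>(1), of t] that by (simp add: algebra_simps)
    with v have "Ds \<xi> + v \<bullet> (t *\<^sub>R (\<zeta> - \<xi>)) \<le> Ds (\<xi> + t *\<^sub>R (\<zeta> - \<xi>))"
      unfolding subdifferential_dual_iff by fastforce
    then have "t * x \<le> t * (t * c)"
      by (simp add: dual_smooth_expansion curvature_scaleR x_def c_def inner_add_left power2_eq_square
          algebra_simps del: scaleR_right_diff_distrib)
    with that show ?thesis by simp
  qed
  have "x \<le> 0"
  proof (rule ccontr)
    assume "\<not> x \<le> 0"
    then have x: "0 < x" by simp
    \<comment> \<open>this segment parameter makes the quadratic error \<open>t * c\<close> smaller than \<open>x\<close>\<close>
    have "x \<le> x / (x + c) * c" by (rule t) (use x c in auto)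
    then have "x * (x + c) \<le> x * c" using x c by (simp add: field_simps)
    with x show False by (simp add: distrib_left mult_le_0_iff)
  qed
  with \<zeta>(2) show "support ?n \<le> \<xi> \<bullet> ?n"
    by (simp add: x_def inner_commute[of ?n] inner_diff_left)
next
  assume "\<xi> \<in> balls \<and> support (v + descent \<xi>) \<le> \<xi> \<bullet> (v + descent \<xi>)"
  then have \<xi>: "\<xi> \<in> balls" and n: "support (v + descent \<xi>) \<le> \<xi> \<bullet> (v + descent \<xi>)" by auto
  show "v \<in> T \<xi>"
    unfolding subdifferential_dual_iff
  proof (intro conjI ballI \<xi>)
    fix \<zeta> assume "\<zeta> \<in> balls"
    then have "\<zeta> \<bullet> (v + descent \<xi>) \<le> \<xi> \<bullet> (v + descent \<xi>)"
      by (rule order_trans[OF inner_le_support n])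
    then show "Ds \<xi> + v \<bullet> (\<zeta> - \<xi>) \<le> Ds \<zeta>"
      using dual_smooth_expansion'[of \<zeta> \<xi>] curvature_nonneg[of "\<zeta> - \<xi>"]
      by (simp add: inner_add_right inner_commute[of v] inner_commute[of "descent \<xi>"] inner_diff_left)
  qed
qed

lemma closed_graph_subdifferential_dual: "closed {(\<xi>, v). v \<in> T \<xi>}"
proof -
  have *: "continuous_on UNIV (\<lambda>p. support (snd p + descent (fst p)))"
    by (rule continuous_on_compose2[OF continuous_on_support[of UNIV] _ subset_UNIV])
       (intro continuous_intros continuous_on_compose2[OF continuous_on_descent[of UNIV] _ subset_UNIV])
  have **: "continuous_on UNIV (\<lambda>p. fst p \<bullet> (snd p + descent (fst p)))"
    by (intro continuous_intros continuous_on_compose2[OF continuous_on_descent[of UNIV]]) simp_all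
  have "{(\<xi>, v). v \<in> T \<xi>} = balls \<times> UNIV \<inter>
      {p. support (snd p + descent (fst p)) \<le> fst p \<bullet> (snd p + descent (fst p))}"
    by (auto simp: subdifferential_dual_normal_iff)
  moreover have "closed \<dots>"
    by (intro closed_Int closed_Times closed_balls closed_UNIV closed_Collect_le * **)
  ultimately show ?thesis by simp
qed

lemma dual_solution_exists: "\<exists>\<xi>. 0 \<in> T \<xi>"
proof -
  have "continuous_on balls (\<lambda>\<xi>. Ds 0 - descent 0 \<bullet> \<xi> + curvature \<xi> / 2)"
    by (intro continuous_intros continuous_on_curvature) simp
  moreover have "Ds 0 - descent 0 \<bullet> \<xi> + curvature \<xi> / 2 = Ds \<xi>" for \<xi>
    using dual_smooth_expansion'[of \<xi> 0] by (simp only: diff_0_right)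
  ultimately have "continuous_on balls Ds" by (rule continuous_on_eq)
  then obtain \<xi> where "\<xi> \<in> balls" "\<forall>\<zeta>\<in>balls. Ds \<xi> \<le> Ds \<zeta>"
    using continuous_attains_inf[OF compact_balls] zero_in_balls by blast
  then have "0 \<in> T \<xi>" by (simp add: subdifferential_dual_iff)
  then show ?thesis ..
qed


section \<open>Metric subregularity of the dual subdifferential\<close>

lemma zero_subdifferential_iff: "0 \<in> T \<xi> \<longleftrightarrow> \<xi> \<in> balls \<and> support (descent \<xi>) \<le> \<xi> \<bullet> descent \<xi>"
  by (simp add: subdifferential_dual_normal_iff)

lemma dual_smooth_GDERIV: "GDERIV Ds \<xi> :> - descent \<xi>"
proof (rule GDERIV_of_quadratic_remainder)
  show "Ds (\<xi> + \<eta>) = Ds \<xi> + - descent \<xi> \<bullet> \<eta> + curvature \<eta> / 2" for \<eta>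
    by (simp add: dual_smooth_expansion)
  show "continuous_on UNIV (\<lambda>\<eta>. curvature \<eta> / 2)" by (intro continuous_intros continuous_on_curvature) simp
qed (simp add: curvature_scaleR)

lemma normal_pointwise:
  assumes \<xi>: "\<xi> \<in> balls" and n: "support n \<le> \<xi> \<bullet> n"
  shows "fst \<xi> $ i \<bullet> fst n $ i = \<alpha>1 * norm (fst n $ i)"
    and "snd \<xi> $ i \<bullet> snd n $ i = \<alpha>0 * norm (snd n $ i)"
proof -
  have ball: "\<And>i. norm (fst \<xi> $ i) \<le> \<alpha>1" "\<And>i. norm (snd \<xi> $ i) \<le> \<alpha>0"
    by (rule ballsD[OF \<xi>])+
  from inner_le_norm1[OF ball(1), of "fst n"] inner_le_norm1[OF ball(2), of "snd n"] n
  have "\<alpha>1 * norm1 (fst n) \<le> fst \<xi> \<bullet> fst n" "\<alpha>0 * norm1 (snd n) \<le> snd \<xi> \<bullet> snd n"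
    by (simp_all add: support_def inner_prod_def)
  then show "fst \<xi> $ i \<bullet> fst n $ i = \<alpha>1 * norm (fst n $ i)"
    and "snd \<xi> $ i \<bullet> snd n $ i = \<alpha>0 * norm (snd n $ i)"
    using norm1_attained_pointwise ball by blast+
qed

text \<open>The quadratic lower bound for the growth of the dual function at a solution whose normal vector is
  \<open>n\<close>: the Hessian form, plus the growth due to the curvature of the balls at the pixels where \<open>n\<close>
  is nonzero.\<close>

definition growth_form :: "('i, 'j) V \<times> ('i, 'j) W \<Rightarrow> ('i, 'j) V \<times> ('i, 'j) W \<Rightarrow> real" where
  "growth_form n \<eta> = curvature \<eta> / 2
     + (\<Sum>i\<in>UNIV. norm (fst n $ i) / (2 * \<alpha>1) * (norm (fst \<eta> $ i))\<^sup>2)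
     + (\<Sum>i\<in>UNIV. norm (snd n $ i) / (2 * \<alpha>0) * (norm (snd \<eta> $ i))\<^sup>2)"

lemma dual_growth:
  assumes \<zeta>: "0 \<in> T \<zeta>" and \<xi>: "\<xi> \<in> balls"
  shows "Ds \<zeta> + growth_form (descent \<zeta>) (\<xi> - \<zeta>) \<le> Ds \<xi>"
proof -
  let ?n = "descent \<zeta>"
  have \<zeta>C: "\<zeta> \<in> balls" and n: "support ?n \<le> \<zeta> \<bullet> ?n" using \<zeta> by (simp_all add: zero_subdifferential_iff)
  have "(\<Sum>i\<in>UNIV. norm (fst ?n $ i) / (2 * \<alpha>1) * (norm (fst (\<xi> - \<zeta>) $ i))\<^sup>2)
      \<le> (\<Sum>i\<in>UNIV. fst ?n $ i \<bullet> fst (\<zeta> - \<xi>) $ i)"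
    using cball_quadratic_growth[OF \<alpha>1_pos ballsD(1)[OF \<xi>] ballsD(1)[OF \<zeta>C] normal_pointwise(1)[OF \<zeta>C n]]
    by (intro sum_mono) simp
  moreover have "(\<Sum>i\<in>UNIV. norm (snd ?n $ i) / (2 * \<alpha>0) * (norm (snd (\<xi> - \<zeta>) $ i))\<^sup>2)
      \<le> (\<Sum>i\<in>UNIV. snd ?n $ i \<bullet> snd (\<zeta> - \<xi>) $ i)"
    using cball_quadratic_growth[OF \<alpha>0_pos ballsD(2)[OF \<xi>] ballsD(2)[OF \<zeta>C] normal_pointwise(2)[OF \<zeta>C n]]
    by (intro sum_mono) simp
  moreover have "(\<Sum>i\<in>UNIV. fst ?n $ i \<bullet> fst (\<zeta> - \<xi>) $ i) + (\<Sum>i\<in>UNIV. snd ?n $ i \<bullet> snd (\<zeta> - \<xi>) $ i)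
      = - (?n \<bullet> (\<xi> - \<zeta>))"
    unfolding inner_vec_def[symmetric] inner_prod_def by (simp add: inner_diff_right)
  ultimately show ?thesis
    using dual_smooth_expansion'[of \<xi> \<zeta>] by (simp only: growth_form_def)
qed

lemma continuous_on_growth_form: "continuous_on S (growth_form n)"
  unfolding growth_form_def[abs_def]
  by (intro continuous_intros continuous_on_curvature) simp

lemma growth_form_scaleR: "growth_form n (t *\<^sub>R \<eta>) = t\<^sup>2 * growth_form n \<eta>"
  by (simp add: growth_form_def curvature_scaleR power_mult_distrib sum_distrib_left distrib_left mult.left_commute)

text \<open>The null space of \<open>growth_form n\<close>, written with linear equations.\<close>

definition flat_directions :: "('i, 'j) V \<times> ('i, 'j) W \<Rightarrow> (('i, 'j) V \<times> ('i, 'j) W) set" where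
  "flat_directions n = {\<eta>. gradT (fst \<eta>) = 0 \<and> fst \<eta> = symgradT (snd \<eta>) \<and>
     (\<forall>i. fst n $ i \<noteq> 0 \<longrightarrow> fst \<eta> $ i = 0) \<and> (\<forall>i. snd n $ i \<noteq> 0 \<longrightarrow> snd \<eta> $ i = 0)}"

lemma subspace_flat_directions: "subspace (flat_directions n)"
  by (rule subspaceI) (auto simp: flat_directions_def ops_simps)

lemma growth_form_pos:
  assumes "\<eta> \<notin> flat_directions n"
  shows "0 < growth_form n \<eta>"
proof (rule ccontr)
  let ?s1 = "\<lambda>i. norm (fst n $ i) / (2 * \<alpha>1) * (norm (fst \<eta> $ i))\<^sup>2"
  let ?s2 = "\<lambda>i. norm (snd n $ i) / (2 * \<alpha>0) * (norm (snd \<eta> $ i))\<^sup>2"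
  have nn1: "0 \<le> ?s1 i" and nn2: "0 \<le> ?s2 i" for i using \<alpha>0_pos \<alpha>1_pos by simp_all
  have "0 \<le> sum ?s1 UNIV" "0 \<le> sum ?s2 UNIV" by (intro sum_nonneg nn1 nn2)+
  moreover assume "\<not> 0 < growth_form n \<eta>"
  ultimately have zero: "curvature \<eta> = 0" "sum ?s1 UNIV = 0" "sum ?s2 UNIV = 0"
    using curvature_nonneg[of \<eta>] unfolding growth_form_def by linarith+
  have "\<forall>i\<in>UNIV. ?s1 i = 0" by (rule iffD1[OF sum_nonneg_eq_0_iff zero(2)]) (rule finite, rule nn1)
  moreover have "\<forall>i\<in>UNIV. ?s2 i = 0" by (rule iffD1[OF sum_nonneg_eq_0_iff zero(3)]) (rule finite, rule nn2)
  ultimately have s: "?s1 i = 0" "?s2 i = 0" for i by blast+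
  have "fst n $ i \<noteq> 0 \<longrightarrow> fst \<eta> $ i = 0" "snd n $ i \<noteq> 0 \<longrightarrow> snd \<eta> $ i = 0" for i
    using s[of i] \<alpha>0_pos \<alpha>1_pos by auto
  moreover have "R (gradT (fst \<eta>)) \<bullet> gradT (fst \<eta>) = 0"
    "1 / a * (norm (fst \<eta> - symgradT (snd \<eta>)))\<^sup>2 = 0"
  proof -
    have "0 \<le> 1 / a * (norm (fst \<eta> - symgradT (snd \<eta>)))\<^sup>2" using a_pos by simp
    with zero(1) R_nonneg[of "gradT (fst \<eta>)"]
    show "R (gradT (fst \<eta>)) \<bullet> gradT (fst \<eta>) = 0"
      "1 / a * (norm (fst \<eta> - symgradT (snd \<eta>)))\<^sup>2 = 0"
      unfolding curvature_def by linarith+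
  qed
  then have "gradT (fst \<eta>) = 0" "fst \<eta> = symgradT (snd \<eta>)"
    using R_zero_iff a_pos by simp_all
  ultimately show False using assms by (simp add: flat_directions_def)
qed

text \<open>Split the displacement from the solution \<open>\<xi>b\<close> into a flat direction \<open>m\<close> and a part \<open>s\<close>
  orthogonal to the flat directions. The point \<open>\<xi>b + m\<close> is again a solution: it has the same
  normal vector, it agrees with \<open>\<xi>b\<close> where that vector is nonzero, and elsewhere it stays inside the
  open ball as \<open>m\<close> is short. From there the dual function grows at least like \<open>c * (norm s)\<^sup>2\<close>,
  while a subgradient \<open>v\<close> at the displaced point allows at most \<open>v \<bullet> s\<close>. So \<open>norm s\<close> is
  bounded by a multiple of \<open>norm v\<close>.\<close>

proposition dual_metrically_subregular:
  assumes \<xi>b: "0 \<in> T \<xi>b"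
    and strict: "\<And>i. fst (descent \<xi>b) $ i = 0 \<Longrightarrow> norm (fst \<xi>b $ i) < \<alpha>1"
      "\<And>i. snd (descent \<xi>b) $ i = 0 \<Longrightarrow> norm (snd \<xi>b $ i) < \<alpha>0"
  shows "\<exists>\<kappa>. metrically_subregular T \<xi>b 0 \<kappa>"
proof -
  let ?n = "descent \<xi>b"
  let ?N = "flat_directions ?n"
  have \<xi>bC: "\<xi>b \<in> balls" and n: "support ?n \<le> \<xi>b \<bullet> ?n" using \<xi>b by (simp_all add: zero_subdifferential_iff)
  define G where "G = (\<Inter>i\<in>{i. fst ?n $ i = 0}. {\<xi>. norm (fst \<xi> $ i) < \<alpha>1})
      \<inter> (\<Inter>i\<in>{i. snd ?n $ i = 0}. {\<xi> :: ('i, 'j) V \<times> ('i, 'j) W. norm (snd \<xi> $ i) < \<alpha>0})"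
  have "open G"
    unfolding G_def by (intro open_Int open_INT ballI open_Collect_less continuous_intros) simp_all
  moreover have "\<xi>b \<in> G" using strict by (simp add: G_def)
  ultimately obtain r where r: "0 < r" "ball \<xi>b r \<subseteq> G" using open_contains_ball by blast
  obtain c where c: "0 < c" "\<And>s. s \<in> ?N\<^sup>\<bottom> \<Longrightarrow> c * (norm s)\<^sup>2 \<le> growth_form ?n s"
  proof (rule quadratic_form_coercive_on_subspace)
    show "0 < growth_form ?n s" if "s \<in> ?N\<^sup>\<bottom>" "s \<noteq> 0" for s
    proof (rule growth_form_pos)
      show "s \<notin> ?N"
        using that by (auto simp: orthogonal_comp_def orthogonal_def)
    qed
  qed (auto intro: continuous_on_growth_form growth_form_scaleR subspace_orthogonal_comp)
  have key: "infdist \<xi> {z. 0 \<in> T z} \<le> 1 / c * norm v" if \<xi>r: "\<xi> \<in> ball \<xi>b r" and v: "v \<in> T \<xi>" for \<xi> v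
  proof -
    obtain m s where m: "m \<in> ?N" and s: "\<And>x. x \<in> ?N \<Longrightarrow> orthogonal s x" and dec: "\<xi> - \<xi>b = m + s"
      using orthogonal_subspace_decomp_exists[of ?N "\<xi> - \<xi>b"] span_eq_iff[THEN iffD2, OF subspace_flat_directions]
      by metis
    define \<zeta> where "\<zeta> = \<xi>b + m"
    have "(norm m)\<^sup>2 \<le> (norm (\<xi> - \<xi>b))\<^sup>2"
      using norm_add_Pythagorean[of m s] s[OF m] by (simp add: dec orthogonal_commute)
    then have "norm m \<le> norm (\<xi> - \<xi>b)" by (rule power2_le_imp_le) simp
    then have "\<zeta> \<in> ball \<xi>b r" using \<xi>r by (simp add: \<zeta>_def dist_norm norm_minus_commute)
    then have "\<zeta> \<in> G" using r by blast
    have \<zeta>C: "\<zeta> \<in> balls"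
    proof -
      have "norm (fst \<zeta> $ i) \<le> \<alpha>1" for i
      proof (cases "fst ?n $ i = 0")
        case True
        with \<open>\<zeta> \<in> G\<close> have "norm (fst \<zeta> $ i) < \<alpha>1" unfolding G_def by blast
        then show ?thesis by simp
      next
        case False
        with m have "fst m $ i = 0" unfolding flat_directions_def by blast
        with ballsD(1)[OF \<xi>bC, of i] show ?thesis by (simp add: \<zeta>_def)
      qed
      moreover have "norm (snd \<zeta> $ i) \<le> \<alpha>0" for i
      proof (cases "snd ?n $ i = 0")
        case True
        with \<open>\<zeta> \<in> G\<close> have "norm (snd \<zeta> $ i) < \<alpha>0" unfolding G_def by blast
        then show ?thesis by simp
      next
        case False
        with m have "snd m $ i = 0" unfolding flat_directions_def by blast
        with ballsD(2)[OF \<xi>bC, of i] show ?thesis by (simp add: \<zeta>_def)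
      qed
      ultimately show ?thesis by (simp add: balls_def)
    qed
    have "fst m \<bullet> fst ?n = 0" "snd m \<bullet> snd ?n = 0"
    proof -
      have "fst m $ i \<bullet> fst ?n $ i = 0" for i
        using m inner_zero_left inner_zero_right unfolding flat_directions_def by (metis (mono_tags, lifting) mem_Collect_eq)
      moreover have "snd m $ i \<bullet> snd ?n $ i = 0" for i
        using m inner_zero_left inner_zero_right unfolding flat_directions_def by (metis (mono_tags, lifting) mem_Collect_eq)
      ultimately show "fst m \<bullet> fst ?n = 0" "snd m \<bullet> snd ?n = 0"
        unfolding inner_vec_def by (simp_all only: sum.neutral_const)
    qed
    then have "m \<bullet> ?n = 0" by (simp add: inner_prod_def)
    moreover have desc: "descent \<zeta> = ?n"
    proof -
      have "gradT (fst m) = 0" "fst m = symgradT (snd m)" using m unfolding flat_directions_def by blast+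
      then have "primal_u \<zeta> = primal_u \<xi>b" "primal_w \<zeta> = primal_w \<xi>b"
        by (simp_all add: primal_u_def primal_w_def \<zeta>_def ops_simps)
      then show ?thesis by (simp only: descent_def)
    qed
    ultimately have \<zeta>: "0 \<in> T \<zeta>"
      using n \<zeta>C by (simp add: zero_subdifferential_iff \<zeta>_def inner_add_left)
    have \<xi>\<zeta>: "\<xi> - \<zeta> = s" using dec by (simp add: \<zeta>_def algebra_simps)
    have \<xi>C: "\<xi> \<in> balls" and "Ds \<xi> + v \<bullet> (\<zeta> - \<xi>) \<le> Ds \<zeta>"
      using v \<zeta>C by (simp_all add: subdifferential_dual_iff)
    moreover have "Ds \<zeta> + growth_form ?n s \<le> Ds \<xi>"
      using dual_growth[OF \<zeta> \<xi>C] by (simp add: desc \<xi>\<zeta>)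
    moreover have "\<zeta> - \<xi> = - s" using \<xi>\<zeta> by (simp add: algebra_simps)
    ultimately have "growth_form ?n s \<le> v \<bullet> s" by simp
    also have "\<dots> \<le> norm v * norm s" by (rule norm_cauchy_schwarz)
    finally have "c * (norm s)\<^sup>2 \<le> norm v * norm s"
      using c(2)[of s] s by (auto simp: orthogonal_comp_def orthogonal_commute)
    then have "c * norm s \<le> norm v"
      by (cases "s = 0") (simp_all add: power2_eq_square)
    then have "norm s \<le> 1 / c * norm v" using c(1) by (simp add: field_simps)
    moreover have "infdist \<xi> {z. 0 \<in> T z} \<le> dist \<xi> \<zeta>" by (rule infdist_le) (use \<zeta> in simp)
    ultimately show ?thesis by (simp add: dist_norm \<xi>\<zeta>)
  qed
  have "infdist \<xi> {z. 0 \<in> T z} \<le> 1 / c * infdist 0 (T \<xi> \<inter> UNIV)"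
    if "\<xi> \<in> ball \<xi>b r" "T \<xi> \<inter> UNIV \<noteq> {}" for \<xi>
    using key[OF that(1)] that(2) c(1) by (intro le_mult_infdistI) (auto simp: dist_norm)
  then have "metrically_subregular T \<xi>b 0 (1 / c)"
    unfolding metrically_subregular_def using \<xi>b c(1) r(1)
    by (intro conjI exI[of _ "ball \<xi>b r"] exI[of _ UNIV]) auto
  then show ?thesis ..
qed

text \<open>The normal vectors in the assumption are minus the gradient of the smooth part, that is, the
  components of \<open>descent\<close>; uniqueness of the gradient identifies them.\<close>

lemma assumption_E_metrically_subregular:
  assumes E: "assumption_E K f0 \<nu> a \<alpha>0 \<alpha>1 l m"
  shows "\<exists>\<kappa>. metrically_subregular T (l, m) 0 \<kappa>"
proof (rule dual_metrically_subregular)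
  from E obtain g \<psi> where sol: "(l, m) \<in> dual_solutions K f0 \<nu> a \<alpha>0 \<alpha>1"
    and grad: "GDERIV Ds (l, m) :> - (g, \<psi>)"
    and g: "\<And>i. norm (l $ i) < \<alpha>1 \<or> g $ i \<noteq> 0" and \<psi>: "\<And>i. norm (m $ i) < \<alpha>0 \<or> \<psi> $ i \<noteq> 0"
    unfolding assumption_E_def by blast
  show "0 \<in> T (l, m)" using sol by (simp add: dual_solutions_eq)
  have "descent (l, m) = (g, \<psi>)"
    using GDERIV_unique[OF dual_smooth_GDERIV grad] by (metis minus_equation_iff)
  then show "fst (descent (l, m)) $ i = 0 \<Longrightarrow> norm (fst (l, m) $ i) < \<alpha>1"
    "snd (descent (l, m)) $ i = 0 \<Longrightarrow> norm (snd (l, m) $ i) < \<alpha>0" for i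
    using g[of i] \<psi>[of i] by auto
qed


section \<open>The augmented Lagrangian step as a proximal step\<close>

text \<open>Expand every term around \<open>(u, w, h1, h2)\<close>. The linear terms cancel up to
  \<open>- (p, q) \<bullet> (h1' - h1, h2' - h2)\<close>, since \<open>(p, q)\<close> is the updated multiplier and \<open>u\<close>, \<open>w\<close>
  solve the linear equations for it. The remainder is absorbed by the 1-norms, of which \<open>(p, q)\<close> is
  a subgradient at \<open>(h1, h2)\<close>. What is left are the quadratic terms. The lemma serves both for a
  step of the algorithm and, with vanishing constraint residual, for the saddle point.\<close>

lemma lagrangian_growth:
  fixes h1 :: "('i, 'j) V" and h2 :: "('i, 'j) W"
  defines "L \<equiv> aug_lagrangian K f0 \<nu> a \<alpha>0 \<alpha>1"
  assumes balls: "(p, q) \<in> balls" and u: "u = primal_u (p, q)" and w: "w = primal_w (p, q)"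
    and h: "support (h1, h2) \<le> (p, q) \<bullet> (h1, h2)"
    and p: "p = l + \<sigma> *\<^sub>R (grad u - w - h1)" and q: "q = m + \<sigma> *\<^sub>R (symgrad w - h2)"
  shows "L \<sigma> (u, w, h1, h2) (l, m) + H (u' - u) \<bullet> (u' - u) / 2 + a / 2 * (norm (w' - w))\<^sup>2
      + \<sigma> / 2 * (norm (grad u' - w' - h1' - (grad u - w - h1)))\<^sup>2
      + \<sigma> / 2 * (norm (symgrad w' - h2' - (symgrad w - h2)))\<^sup>2
    \<le> L \<sigma> (u', w', h1', h2') (l, m)"
proof -
  let ?A = "grad u - w - h1" and ?A' = "grad u' - w' - h1'"
  let ?B = "symgrad w - h2" and ?B' = "symgrad w' - h2'"
  have sq: "c / 2 * (norm y)\<^sup>2 = c / 2 * (norm x)\<^sup>2 + (c *\<^sub>R x) \<bullet> (y - x) + c / 2 * (norm (y - x))\<^sup>2"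
    for x y :: "'b::real_inner" and c
    unfolding power2_norm_eq_inner
    by (simp add: inner_diff_left inner_diff_right inner_commute[of y x] algebra_simps)
  have pen: "z \<bullet> y + \<sigma> / 2 * (norm y)\<^sup>2
      = z \<bullet> x + \<sigma> / 2 * (norm x)\<^sup>2 + (z + \<sigma> *\<^sub>R x) \<bullet> (y - x) + \<sigma> / 2 * (norm (y - x))\<^sup>2"
    for x y z :: "'b::real_inner"
    using sq[of \<sigma> y x] by (simp add: inner_add_left inner_diff_right)
  have data: "1/2 * (norm (K u' - f0))\<^sup>2 + \<nu> / 2 * (norm (grad u'))\<^sup>2
      = 1/2 * (norm (K u - f0))\<^sup>2 + \<nu> / 2 * (norm (grad u))\<^sup>2 - p \<bullet> grad (u' - u)
        + H (u' - u) \<bullet> (u' - u) / 2"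
  proof -
    have "H u - f = - gradT p" by (simp add: u primal_u_def)
    then have "(H u - f) \<bullet> (u' - u) = - (p \<bullet> grad (u' - u))" by (simp add: inner_gradT)
    moreover have "f \<bullet> (u' - u) = f0 \<bullet> K (u' - u)"
      using adjoint_works[OF linear_K, of "u' - u" f0] by (simp add: inner_commute)
    moreover have "K u' - f0 - (K u - f0) = K (u' - u)" "grad u' - grad u = grad (u' - u)"
      by (simp_all add: linear_diff[OF linear_K] linear_diff[OF linear_grad])
    ultimately show ?thesis
      using sq[of 1 "K u' - f0" "K u - f0"] sq[of \<nu> "grad u'" "grad u"]
      by (simp add: inner_H inner_diff_left power2_norm_eq_inner[of "K (u' - u)"]
          power2_norm_eq_inner[of "grad (u' - u)"] add_divide_distrib diff_divide_distrib)
  qed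
  have aw: "a / 2 * (norm w')\<^sup>2 = a / 2 * (norm w)\<^sup>2 + p \<bullet> (w' - w) - q \<bullet> symgrad (w' - w)
      + a / 2 * (norm (w' - w))\<^sup>2"
  proof -
    have "a *\<^sub>R w = p - symgradT q" using a_pos by (simp add: w primal_w_def)
    then show ?thesis using sq[of a w' w] by (simp add: inner_diff_left inner_symgradT)
  qed
  have "p \<bullet> (?A' - ?A) = p \<bullet> grad (u' - u) - p \<bullet> (w' - w) - p \<bullet> h1' + p \<bullet> h1"
    "q \<bullet> (?B' - ?B) = q \<bullet> symgrad (w' - w) - q \<bullet> h2' + q \<bullet> h2"
    by (simp_all add: linear_diff[OF linear_grad] linear_diff[OF linear_symgrad] inner_diff_right)
  moreover have "p \<bullet> h1' + q \<bullet> h2' \<le> \<alpha>1 * norm1 h1' + \<alpha>0 * norm1 h2'"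
    using inner_le_support[OF balls, of "(h1', h2')"] by (simp add: support_def)
  moreover have "\<alpha>1 * norm1 h1 + \<alpha>0 * norm1 h2 \<le> p \<bullet> h1 + q \<bullet> h2"
    using h by (simp add: support_def)
  ultimately show ?thesis
    using data aw pen[of l ?A' ?A] pen[of m ?B' ?B]
    unfolding L_def aug_lagrangian_def prod.case p[symmetric] q[symmetric] by linarith
qed

lemma H_nonneg: "0 \<le> H x \<bullet> x"
  using H_pos[of x] linear_0[OF linear_H] by (cases "x = 0") (simp_all add: less_imp_le)

lemma dual_solution_saddle_point:
  assumes \<xi>: "0 \<in> T \<xi>" and s: "0 < s"
  shows "saddle_point (aug_lagrangian K f0 \<nu> a \<alpha>0 \<alpha>1 s)
    (primal_u \<xi>, primal_w \<xi>, fst (descent \<xi>), snd (descent \<xi>)) \<xi>"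
proof -
  let ?x = "(primal_u \<xi>, primal_w \<xi>, fst (descent \<xi>), snd (descent \<xi>))"
  obtain p q where pq: "\<xi> = (p, q)" by (cases \<xi>)
  have "aug_lagrangian K f0 \<nu> a \<alpha>0 \<alpha>1 s ?x \<eta> = aug_lagrangian K f0 \<nu> a \<alpha>0 \<alpha>1 s ?x \<xi>" for \<eta>
    by (cases \<eta>) (simp add: aug_lagrangian_def descent_def pq)
  moreover have "aug_lagrangian K f0 \<nu> a \<alpha>0 \<alpha>1 s ?x \<xi> \<le> aug_lagrangian K f0 \<nu> a \<alpha>0 \<alpha>1 s x \<xi>" for x
  proof -
    obtain u' w' h1' h2' where x: "x = (u', w', h1', h2')" by (cases x)
    have "aug_lagrangian K f0 \<nu> a \<alpha>0 \<alpha>1 s ?x (p, q)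
        + H (u' - primal_u \<xi>) \<bullet> (u' - primal_u \<xi>) / 2 + a / 2 * (norm (w' - primal_w \<xi>))\<^sup>2
        + s / 2 * (norm (grad u' - w' - h1' - (grad (primal_u \<xi>) - primal_w \<xi> - fst (descent \<xi>))))\<^sup>2
        + s / 2 * (norm (symgrad w' - h2' - (symgrad (primal_w \<xi>) - snd (descent \<xi>))))\<^sup>2
      \<le> aug_lagrangian K f0 \<nu> a \<alpha>0 \<alpha>1 s x (p, q)"
      unfolding x
      by (rule lagrangian_growth[where p = p and q = q])
         (use \<xi> in \<open>simp_all add: pq zero_subdifferential_iff\<close>, simp_all add: descent_def)
    moreover have "0 \<le> a / 2 * (norm (w' - primal_w \<xi>))\<^sup>2" "0 \<le> s / 2 * (norm y)\<^sup>2"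
      "0 \<le> s / 2 * (norm z)\<^sup>2" for y :: "('i, 'j) V" and z :: "('i, 'j) W"
      using a_pos s by simp_all
    ultimately show ?thesis
      using H_nonneg[of "u' - primal_u \<xi>"] unfolding pq by (smt (verit, best) divide_nonneg_pos)
  qed
  ultimately show ?thesis unfolding saddle_point_def by (metis order_refl)
qed

text \<open>A solution of the optimality system, completed by the \<open>h1\<close> and \<open>h2\<close> that the multiplier update
  defines, meets the conditions of the growth estimate: \<open>h1\<close> and \<open>h2\<close> are multiples of
  projection residuals, hence normal to the balls at \<open>p\<close> and \<open>q\<close>.\<close>

lemma opt_residual_solution:
  assumes \<sigma>: "0 < \<sigma>" and z: "opt_residual K f0 \<nu> a \<alpha>0 \<alpha>1 \<sigma> l m (u, w, p, q) = 0"
  defines "h1 \<equiv> grad u - w - (1 / \<sigma>) *\<^sub>R (p - l)" and "h2 \<equiv> symgrad w - (1 / \<sigma>) *\<^sub>R (q - m)"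
  shows "(p, q) \<in> balls" "u = primal_u (p, q)" "w = primal_w (p, q)"
    "support (h1, h2) \<le> (p, q) \<bullet> (h1, h2)"
    "p = l + \<sigma> *\<^sub>R (grad u - w - h1)" "q = m + \<sigma> *\<^sub>R (symgrad w - h2)"
proof -
  define z1 where "z1 = l + \<sigma> *\<^sub>R (grad u - w)"
  define z2 where "z2 = m + \<sigma> *\<^sub>R symgrad w"
  have "H u - f + gradT p = 0 \<and> a *\<^sub>R w - p + symgradT q = 0
      \<and> p = proj_ball \<alpha>1 z1 \<and> q = proj_ball \<alpha>0 z2"
    using z unfolding opt_residual_def prod.case zero_prod_def prod.inject right_minus_eq z1_def z2_def .
  then have eqs: "H u - f + gradT p = 0" "a *\<^sub>R w - p + symgradT q = 0"
    and p: "p = proj_ball \<alpha>1 z1" and q: "q = proj_ball \<alpha>0 z2"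
    by blast+
  show "(p, q) \<in> balls" by (simp add: balls_def p q proj_ball_norm_le \<alpha>0_pos \<alpha>1_pos)
  have "H u = f - gradT p" using eqs(1) by (simp add: algebra_simps eq_neg_iff_add_eq_0)
  then have "R (H u) = R (f - gradT p)" by (rule arg_cong)
  then show "u = primal_u (p, q)" by (simp add: primal_u_def)
  have "a *\<^sub>R w = p - symgradT q" using eqs(2) by (simp add: algebra_simps)
  then have "(1 / a) *\<^sub>R (a *\<^sub>R w) = (1 / a) *\<^sub>R (p - symgradT q)" by (rule arg_cong)
  then show "w = primal_w (p, q)" using a_pos by (simp add: primal_w_def)
  have "h1 = (1 / \<sigma>) *\<^sub>R (z1 - proj_ball \<alpha>1 z1)" "h2 = (1 / \<sigma>) *\<^sub>R (z2 - proj_ball \<alpha>0 z2)"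
    using \<sigma> by (simp_all add: h1_def h2_def p[symmetric] q[symmetric])
      (simp_all add: z1_def z2_def algebra_simps)
  then show "support (h1, h2) \<le> (p, q) \<bullet> (h1, h2)"
    using proj_ball_normal[OF \<alpha>1_pos, of z1] proj_ball_normal[OF \<alpha>0_pos, of z2] \<sigma>
    by (simp add: support_def norm1_scaleR p[symmetric] q[symmetric] del: scaleR_right_diff_distrib)
  show "p = l + \<sigma> *\<^sub>R (grad u - w - h1)" "q = m + \<sigma> *\<^sub>R (symgrad w - h2)"
    using \<sigma> by (simp_all add: h1_def h2_def)
qed

text \<open>One step of the method is one proximal step for \<open>T\<close> with error \<open>e\<close>. In the growth estimate the
  penalty terms are \<open>1 / (2 * \<sigma>)\<close> times the squared distance of the computed multipliers to the
  exact ones, which explains the form of the stopping criterion.\<close>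

lemma inexact_step:
  fixes l l' p :: "('i, 'j) V" and m m' q :: "('i, 'j) W" and \<sigma> e :: real
  defines "\<Phi> \<equiv> \<lambda>x. aug_lagrangian K f0 \<nu> a \<alpha>0 \<alpha>1 \<sigma> x (l, m)"
  assumes \<sigma>: "0 < \<sigma>" and z: "opt_residual K f0 \<nu> a \<alpha>0 \<alpha>1 \<sigma> l m (u, w, p, q) = 0"
    and l': "l' = l + \<sigma> *\<^sub>R (grad u' - w' - h1')" and m': "m' = m + \<sigma> *\<^sub>R (symgrad w' - h2')"
    and e: "0 \<le> e" and stop: "\<Phi> (u', w', h1', h2') - (INF x. \<Phi> x) \<le> e\<^sup>2 / (2 * \<sigma>)"
  shows "(1 / \<sigma>) *\<^sub>R ((l, m) - (p, q)) \<in> T (p, q)"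
    and "norm ((l', m') - (p, q)) \<le> e"
    and "H (u' - primal_u (p, q)) \<bullet> (u' - primal_u (p, q)) \<le> e\<^sup>2 / \<sigma>"
    and "a * (norm (w' - primal_w (p, q)))\<^sup>2 \<le> e\<^sup>2 / \<sigma>"
proof -
  define h1 where "h1 = grad u - w - (1 / \<sigma>) *\<^sub>R (p - l)"
  define h2 where "h2 = symgrad w - (1 / \<sigma>) *\<^sub>R (q - m)"
  note opt = opt_residual_solution[OF \<sigma> z, folded h1_def h2_def]
  have desc: "descent (p, q) = (grad u - w, symgrad w)"
    by (simp only: descent_def opt(2,3)[symmetric])
  have "(1 / \<sigma>) *\<^sub>R ((l, m) - (p, q)) + descent (p, q) = (h1, h2)"
    by (simp add: desc h1_def h2_def algebra_simps)
  then show "(1 / \<sigma>) *\<^sub>R ((l, m) - (p, q)) \<in> T (p, q)"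
    unfolding subdifferential_dual_normal_iff using opt(1,4) by simp
  let ?A = "\<lambda>u' w' h1'. grad u' - w' - h1' - (grad u - w - h1)"
  let ?B = "\<lambda>w' h2'. symgrad w' - h2' - (symgrad w - h2)"
  have growth: "\<Phi> (u, w, h1, h2) + H (u' - u) \<bullet> (u' - u) / 2 + a / 2 * (norm (w' - w))\<^sup>2
      + \<sigma> / 2 * (norm (?A u' w' h1'))\<^sup>2 + \<sigma> / 2 * (norm (?B w' h2'))\<^sup>2 \<le> \<Phi> (u', w', h1', h2')"
    for u' w' h1' h2'
    unfolding \<Phi>_def by (rule lagrangian_growth[OF opt])
  have nn: "0 \<le> H x \<bullet> x / 2" "0 \<le> a / 2 * (norm y)\<^sup>2" "0 \<le> \<sigma> / 2 * (norm v)\<^sup>2" "0 \<le> \<sigma> / 2 * (norm t)\<^sup>2"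
    for x :: "('i, 'j) U" and y v :: "('i, 'j) V" and t :: "('i, 'j) W"
    using H_nonneg[of x] a_pos \<sigma> by simp_all
  have "\<Phi> (u, w, h1, h2) \<le> \<Phi> x" for x
  proof -
    obtain u' w' h1' h2' where x: "x = (u', w', h1', h2')" by (cases x)
    show ?thesis
      using growth[of u' w' h1' h2'] nn(1)[of "u' - u"] nn(2)[of "w' - w"] nn(3)[of "?A u' w' h1'"]
        nn(4)[of "?B w' h2'"] unfolding x by linarith
  qed
  then have "bdd_below (range \<Phi>)" unfolding bdd_below_def by blast
  then have "(INF x. \<Phi> x) \<le> \<Phi> (u, w, h1, h2)" by (rule cINF_lower) simp
  with stop growth[of u' w' h1' h2']
  have le: "H (u' - u) \<bullet> (u' - u) / 2 + a / 2 * (norm (w' - w))\<^sup>2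
      + \<sigma> / 2 * (norm (?A u' w' h1'))\<^sup>2 + \<sigma> / 2 * (norm (?B w' h2'))\<^sup>2 \<le> e\<^sup>2 / (2 * \<sigma>)"
    by linarith
  note parts = nn(1)[of "u' - u"] nn(2)[of "w' - w"] nn(3)[of "?A u' w' h1'"] nn(4)[of "?B w' h2'"]
  define E where "E = e\<^sup>2 / \<sigma>"
  have half: "e\<^sup>2 / (2 * \<sigma>) = E / 2" by (simp add: E_def)
  have "H (u' - u) \<bullet> (u' - u) \<le> E"
    using le parts unfolding half by linarith
  moreover have "a * (norm (w' - w))\<^sup>2 \<le> E"
    using le parts times_divide_eq_left[of a 2 "(norm (w' - w))\<^sup>2"] unfolding half by linarith
  ultimately show "H (u' - primal_u (p, q)) \<bullet> (u' - primal_u (p, q)) \<le> e\<^sup>2 / \<sigma>"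
    "a * (norm (w' - primal_w (p, q)))\<^sup>2 \<le> e\<^sup>2 / \<sigma>"
    by (simp_all only: opt(2,3)[symmetric] E_def)
  have update_diff: "x - y = \<sigma> *\<^sub>R (b - c)" if "x = v + \<sigma> *\<^sub>R b" "y = v + \<sigma> *\<^sub>R c"
    for x y v b c :: "'b::real_vector"
    using that by (simp add: scaleR_diff_right)
  have "l' - p = \<sigma> *\<^sub>R ?A u' w' h1'" "m' - q = \<sigma> *\<^sub>R ?B w' h2'"
    by (rule update_diff[OF l' opt(5)], rule update_diff[OF m' opt(6)])
  then have "(norm ((l', m') - (p, q)))\<^sup>2 = \<sigma>\<^sup>2 * (norm (?A u' w' h1'))\<^sup>2 + \<sigma>\<^sup>2 * (norm (?B w' h2'))\<^sup>2"
    by (simp add: norm_Pair power_mult_distrib del: scaleR_right_diff_distrib)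
  also have "\<dots> = 2 * \<sigma> * (\<sigma> / 2 * (norm (?A u' w' h1'))\<^sup>2 + \<sigma> / 2 * (norm (?B w' h2'))\<^sup>2)"
    by (simp add: power2_eq_square algebra_simps)
  also have "\<dots> \<le> 2 * \<sigma> * (e\<^sup>2 / (2 * \<sigma>))"
    using le parts(1,2) \<sigma> by (intro mult_left_mono) linarith+
  also have "\<dots> = e\<^sup>2" using \<sigma> by simp
  finally show "norm ((l', m') - (p, q)) \<le> e" using e by (rule power2_le_imp_le)
qed

lemma continuous_primal: "continuous_on S primal_u" "continuous_on S primal_w"
  unfolding primal_u_def[abs_def] primal_w_def[abs_def] by (intro continuous_intros)+

lemma primal_convergence:
  assumes \<eta>: "\<eta> \<longlonglongrightarrow> \<xi>s" and \<epsilon>: "\<epsilon> \<longlonglongrightarrow> 0" and s: "0 < s" "\<And>k. s \<le> \<sigma> k"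
    and u: "\<And>k. H (u k - primal_u (\<eta> k)) \<bullet> (u k - primal_u (\<eta> k)) \<le> (\<epsilon> k)\<^sup>2 / \<sigma> k"
    and w: "\<And>k. a * (norm (w k - primal_w (\<eta> k)))\<^sup>2 \<le> (\<epsilon> k)\<^sup>2 / \<sigma> k"
  shows "u \<longlonglongrightarrow> primal_u \<xi>s" and "w \<longlonglongrightarrow> primal_w \<xi>s"
proof -
  have lim: "x \<longlonglongrightarrow> y" if c: "0 < c" and le: "\<And>k. c * (norm (x k - z k))\<^sup>2 \<le> (\<epsilon> k)\<^sup>2 / \<sigma> k"
    and z: "z \<longlonglongrightarrow> y" for c and x z :: "nat \<Rightarrow> 'b::real_normed_vector" and y
  proof -
    have "(norm (x k - z k))\<^sup>2 \<le> (\<epsilon> k)\<^sup>2 / s / c" for k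
    proof -
      have "c * (norm (x k - z k))\<^sup>2 \<le> (\<epsilon> k)\<^sup>2 / s"
        using le[of k] divide_left_mono[OF s(2)[of k], of "(\<epsilon> k)\<^sup>2"] s(1) s(2)[of k] by simp
      then show ?thesis using c by (simp only: pos_le_divide_eq mult.commute)
    qed
    then have "\<forall>\<^sub>F k in sequentially. norm ((norm (x k - z k))\<^sup>2) \<le> (\<epsilon> k)\<^sup>2 / s / c" by simp
    moreover have "(\<lambda>k. (\<epsilon> k)\<^sup>2 / s / c) \<longlonglongrightarrow> 0\<^sup>2 / s / c"
      using s c by (intro tendsto_intros \<epsilon>) simp_all
    then have "(\<lambda>k. (\<epsilon> k)\<^sup>2 / s / c) \<longlonglongrightarrow> 0" by simp
    ultimately have "(\<lambda>k. (norm (x k - z k))\<^sup>2) \<longlonglongrightarrow> 0" by (rule Lim_null_comparison)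
    then have "(\<lambda>k. norm (x k - z k)) \<longlonglongrightarrow> 0" by simp
    then have "(\<lambda>k. x k - z k) \<longlonglongrightarrow> 0" by (rule tendsto_norm_zero_cancel)
    from tendsto_add[OF this z] show ?thesis by simp
  qed
  obtain c where c: "0 < c" "\<And>x. c * (norm x)\<^sup>2 \<le> H x \<bullet> x"
  proof (rule quadratic_form_coercive_on_subspace[of "\<lambda>x. H x \<bullet> x" UNIV])
    show "continuous_on UNIV (\<lambda>x. H x \<bullet> x)"
      by (intro continuous_intros linear_continuous_on_compose[OF _ linear_H])
    show "H (t *\<^sub>R x) \<bullet> (t *\<^sub>R x) = t\<^sup>2 * (H x \<bullet> x)" for t x
      by (simp add: linear_cmul[OF linear_H] power2_eq_square)
  qed (auto intro: H_pos)
  have "(\<lambda>k. primal_u (\<eta> k)) \<longlonglongrightarrow> primal_u \<xi>s" "(\<lambda>k. primal_w (\<eta> k)) \<longlonglongrightarrow> primal_w \<xi>s"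
    by (rule continuous_on_tendsto_compose[OF _ \<eta>], rule continuous_primal[of UNIV]; simp)+
  then show "u \<longlonglongrightarrow> primal_u \<xi>s" "w \<longlonglongrightarrow> primal_w \<xi>s"
    using lim[of c u "\<lambda>k. primal_u (\<eta> k)" "primal_u \<xi>s", OF c(1) order_trans[OF c(2) u]]
      lim[of a w "\<lambda>k. primal_w (\<eta> k)" "primal_w \<xi>s", OF a_pos w] by blast+
qed

end

section \<open>Convergence of the augmented Lagrangian method\<close>

lemma subregular_rate_less_one:
  assumes "0 \<le> \<kappa>" "0 < (s::real)"
  shows "\<kappa> * (\<kappa>\<^sup>2 + s\<^sup>2) powr (- 1/2) < 1"
proof -
  have pos: "0 < \<kappa>\<^sup>2 + s\<^sup>2" by (rule add_nonneg_pos) (use assms in simp_all)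
  have "\<kappa> < sqrt (\<kappa>\<^sup>2 + s\<^sup>2)" using assms by (intro real_less_rsqrt) simp
  moreover have "(\<kappa>\<^sup>2 + s\<^sup>2) powr (- 1/2) = 1 / sqrt (\<kappa>\<^sup>2 + s\<^sup>2)"
    using powr_minus_divide[of "\<kappa>\<^sup>2 + s\<^sup>2" "1/2"] powr_half_sqrt[of "\<kappa>\<^sup>2 + s\<^sup>2"] pos by simp
  ultimately show ?thesis using pos by (simp add: pos_divide_less_eq)
qed

lemma subregular_rate_tendsto:
  assumes "0 < (s::real)" "\<sigma> \<longlonglongrightarrow> s" "\<delta> \<longlonglongrightarrow> (0::real)"
  shows "(\<lambda>k. (\<kappa> * (\<kappa>\<^sup>2 + (\<sigma> k)\<^sup>2) powr (- 1/2) + \<delta> k) * inverse (1 - \<delta> k))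
    \<longlonglongrightarrow> \<kappa> * (\<kappa>\<^sup>2 + s\<^sup>2) powr (- 1/2)"
proof -
  have "0 < \<kappa>\<^sup>2 + s\<^sup>2" by (rule add_nonneg_pos) (use assms in simp_all)
  then have "(\<lambda>k. (\<kappa> * (\<kappa>\<^sup>2 + (\<sigma> k)\<^sup>2) powr (- 1/2) + \<delta> k) * inverse (1 - \<delta> k))
    \<longlonglongrightarrow> (\<kappa> * (\<kappa>\<^sup>2 + s\<^sup>2) powr (- 1/2) + 0) * inverse (1 - 0)"
    using assms by (intro tendsto_intros) auto
  then show ?thesis by simp
qed

theorem theorem3:
  fixes K :: "('i::{finite,linorder}, 'j::{finite,linorder}) U \<Rightarrow> ('i, 'j) U"
    and f0 :: "('i, 'j) U" and \<nu> a \<alpha>0 \<alpha>1 \<sigma>inf :: real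
    and \<sigma> \<epsilon> :: "nat \<Rightarrow> real"
    and u :: "nat \<Rightarrow> ('i, 'j) U" and w h1 lam :: "nat \<Rightarrow> ('i, 'j) V"
    and h2 mu :: "nat \<Rightarrow> ('i, 'j) W"
  defines "L \<equiv> aug_lagrangian K f0 \<nu> a \<alpha>0 \<alpha>1"
    and "X \<equiv> dual_solutions K f0 \<nu> a \<alpha>0 \<alpha>1"
    and "T \<equiv> subdifferential (dual_fun K f0 \<nu> a \<alpha>0 \<alpha>1)"
  defines "\<Phi> \<equiv> \<lambda>k x. L (\<sigma> k) x (lam k, mu k)"
  assumes "linear K" and "0 < a" and "0 < \<alpha>0" and "0 < \<alpha>1" and "0 \<le> \<nu>"
    and "positive_definite (H_op K \<nu>)"
    and "\<And>k. 0 < \<sigma> k" and "\<And>k. \<sigma> k \<le> \<sigma> (Suc k)" and "\<sigma> \<longlonglongrightarrow> \<sigma>inf"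
    and "alm_pdp K f0 \<nu> a \<alpha>0 \<alpha>1 \<sigma> u w h1 h2 lam mu"
    and "\<And>k. 0 \<le> \<epsilon> k" and "summable \<epsilon>"
    and A: "\<And>k. \<Phi> k (u (Suc k), w (Suc k), h1 (Suc k), h2 (Suc k)) - (INF x. \<Phi> k x)
                \<le> (\<epsilon> k)\<^sup>2 / (2 * \<sigma> k)"
  shows "bounded (range (\<lambda>k. (u k, w k, h1 k, h2 k, lam k, mu k))) \<and>
    (\<exists>us ws h1s h2s lams mus.
      (\<lambda>k. (u k, w k, h1 k, h2 k, lam k, mu k)) \<longlonglongrightarrow> (us, ws, h1s, h2s, lams, mus) \<and>
      (\<forall>s>0. saddle_point (L s) (us, ws, h1s, h2s) (lams, mus)) \<and>
      (\<forall>lamb mub. assumption_E K f0 \<nu> a \<alpha>0 \<alpha>1 lamb mub \<longrightarrow>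
        (\<exists>\<kappa>. metrically_subregular T (lamb, mub) 0 \<kappa>) \<and>
        (\<forall>\<kappa> \<delta>. metrically_subregular T (lamb, mub) 0 \<kappa> \<and> (\<forall>k. 0 \<le> \<delta> k) \<and> summable \<delta> \<and>
           (\<forall>k. \<Phi> k (u (Suc k), w (Suc k), h1 (Suc k), h2 (Suc k)) - (INF x. \<Phi> k x)
                \<le> (\<delta> k)\<^sup>2 / (2 * \<sigma> k)
                   * ((norm (lam (Suc k) - lam k))\<^sup>2 + (norm (mu (Suc k) - mu k))\<^sup>2)) \<longrightarrow>
           (let \<xi> = (\<lambda>k. (lam k, mu k));
                \<theta> = (\<lambda>k. (\<kappa> * (\<kappa>\<^sup>2 + (\<sigma> k)\<^sup>2) powr (- 1/2) + \<delta> k) * inverse (1 - \<delta> k));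
                \<theta>inf = \<kappa> * (\<kappa>\<^sup>2 + \<sigma>inf\<^sup>2) powr (- 1/2)
            in \<xi> \<longlonglongrightarrow> (lams, mus) \<and> (lams, mus) \<in> X \<and>
               (metrically_subregular T (lams, mus) 0 \<kappa> \<longrightarrow>
                  (\<forall>\<^sub>F k in sequentially. infdist (\<xi> (Suc k)) X \<le> \<theta> k * infdist (\<xi> k) X)) \<and>
               \<theta> \<longlonglongrightarrow> \<theta>inf \<and> \<theta>inf < 1))))"
proof -
  interpret tgv_problem K f0 \<nu> a \<alpha>0 \<alpha>1
    by (rule tgv_problem.intro) fact+
  define \<xi> where "\<xi> = (\<lambda>k. (lam k, mu k))"
  have X: "X = {z. 0 \<in> T z}" unfolding X_def T_def by (rule dual_solutions_eq)
  have \<sigma>mono: "\<sigma> 0 \<le> \<sigma> k" for k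
    by (rule lift_Suc_mono_le[of \<sigma>]) (use assms(12) in auto)
  have \<sigma>inf: "0 < \<sigma>inf"
    using LIMSEQ_le_const[OF \<open>\<sigma> \<longlonglongrightarrow> \<sigma>inf\<close>, of "\<sigma> 0"] \<sigma>mono \<open>0 < \<sigma> 0\<close> by fastforce
  from \<open>alm_pdp K f0 \<nu> a \<alpha>0 \<alpha>1 \<sigma> u w h1 h2 lam mu\<close>
  have sol: "\<exists>zs. opt_residual K f0 \<nu> a \<alpha>0 \<alpha>1 (\<sigma> k) (lam k) (mu k) zs = 0"
    and lam: "lam (Suc k) = lam k + \<sigma> k *\<^sub>R (grad (u (Suc k)) - w (Suc k) - h1 (Suc k))"
    and mu: "mu (Suc k) = mu k + \<sigma> k *\<^sub>R (symgrad (w (Suc k)) - h2 (Suc k))" for k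
    unfolding alm_pdp_def ssn_iterates_def by blast+
  obtain \<eta> where \<eta>: "\<exists>u w. opt_residual K f0 \<nu> a \<alpha>0 \<alpha>1 (\<sigma> k) (lam k) (mu k) (u, w, \<eta> k) = 0" for k
  proof -
    have "\<exists>e u w. opt_residual K f0 \<nu> a \<alpha>0 \<alpha>1 (\<sigma> k) (lam k) (mu k) (u, w, e) = 0" for k
    proof -
      obtain zs where zs: "opt_residual K f0 \<nu> a \<alpha>0 \<alpha>1 (\<sigma> k) (lam k) (mu k) zs = 0" using sol by blast
      obtain u w e where "zs = (u, w, e)" by (cases zs rule: prod_cases3)
      with zs show ?thesis by blast
    qed
    then have "\<exists>\<eta>. \<forall>k. \<exists>u w. opt_residual K f0 \<nu> a \<alpha>0 \<alpha>1 (\<sigma> k) (lam k) (mu k) (u, w, \<eta> k) = 0"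
      by (intro choice allI)
    with that show thesis by blast
  qed
  have step: "(1 / \<sigma> k) *\<^sub>R (\<xi> k - \<eta> k) \<in> T (\<eta> k)"
    and err: "norm (\<xi> (Suc k) - \<eta> k) \<le> e"
    and u_err: "H (u (Suc k) - primal_u (\<eta> k)) \<bullet> (u (Suc k) - primal_u (\<eta> k)) \<le> e\<^sup>2 / \<sigma> k"
    and w_err: "a * (norm (w (Suc k) - primal_w (\<eta> k)))\<^sup>2 \<le> e\<^sup>2 / \<sigma> k"
    if "0 \<le> e" and "\<Phi> k (u (Suc k), w (Suc k), h1 (Suc k), h2 (Suc k)) - (INF x. \<Phi> k x)
        \<le> e\<^sup>2 / (2 * \<sigma> k)" for k e
  proof -
    obtain u' w' where z: "opt_residual K f0 \<nu> a \<alpha>0 \<alpha>1 (\<sigma> k) (lam k) (mu k) (u', w', fst (\<eta> k), snd (\<eta> k)) = 0"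
      using \<eta>[of k] by auto
    note step = inexact_step[OF \<open>0 < \<sigma> k\<close> z lam mu that[unfolded \<Phi>_def L_def]]
    show "(1 / \<sigma> k) *\<^sub>R (\<xi> k - \<eta> k) \<in> T (\<eta> k)" "norm (\<xi> (Suc k) - \<eta> k) \<le> e"
      "H (u (Suc k) - primal_u (\<eta> k)) \<bullet> (u (Suc k) - primal_u (\<eta> k)) \<le> e\<^sup>2 / \<sigma> k"
      "a * (norm (w (Suc k) - primal_w (\<eta> k)))\<^sup>2 \<le> e\<^sup>2 / \<sigma> k"
      using step by (simp_all only: T_def \<xi>_def prod.collapse)
  qed
  note A_step = step[OF \<open>0 \<le> \<epsilon> _\<close> A]
  obtain \<xi>s where \<xi>s: "\<xi> \<longlonglongrightarrow> \<xi>s" "\<eta> \<longlonglongrightarrow> \<xi>s" "0 \<in> T \<xi>s"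
    and v0: "(\<lambda>k. (1 / \<sigma> k) *\<^sub>R (\<xi> k - \<eta> k)) \<longlonglongrightarrow> 0"
  proof -
    obtain z0 where "0 \<in> T z0" using dual_solution_exists unfolding T_def by blast
    from inexact_proximal_point_convergence[OF monotone_subdifferential_dual
      closed_graph_subdifferential_dual, folded T_def, OF this \<sigma>mono \<open>0 < \<sigma> 0\<close> A_step
      err[OF \<open>0 \<le> \<epsilon> _\<close> A] \<open>summable \<epsilon>\<close>] that
    show thesis by blast
  qed
  obtain lams mus where ms: "\<xi>s = (lams, mus)" by (cases \<xi>s)
  define us ws where "us = primal_u \<xi>s" and "ws = primal_w \<xi>s"
  have lam_lim: "lam \<longlonglongrightarrow> lams" and mu_lim: "mu \<longlonglongrightarrow> mus"
    using tendsto_fst[OF \<xi>s(1)] tendsto_snd[OF \<xi>s(1)] by (simp_all add: \<xi>_def ms)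
  have "(\<lambda>k. u (Suc k)) \<longlonglongrightarrow> us" "(\<lambda>k. w (Suc k)) \<longlonglongrightarrow> ws"
    unfolding us_def ws_def
    by (rule primal_convergence[OF \<xi>s(2) summable_LIMSEQ_zero[OF \<open>summable \<epsilon>\<close>] \<open>0 < \<sigma> 0\<close> \<sigma>mono
          u_err[OF \<open>0 \<le> \<epsilon> _\<close> A] w_err[OF \<open>0 \<le> \<epsilon> _\<close> A]])+
  note uw_lim = this
  \<comment> \<open>the split variables need not be near-optimal by themselves, but the update determines them\<close>
  have "(\<lambda>k. grad (u (Suc k)) - w (Suc k) - (1 / \<sigma> k) *\<^sub>R (lam (Suc k) - lam k))
      \<longlonglongrightarrow> grad us - ws - (1 / \<sigma>inf) *\<^sub>R (lams - lams)"
    using \<sigma>inf by (intro tendsto_intros bounded_linear.tendsto[OF linear_grad[unfolded linear_conv_bounded_linear]] uw_lim LIMSEQ_Suc lam_lim \<open>\<sigma> \<longlonglongrightarrow> \<sigma>inf\<close>) simp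
  moreover have "grad (u (Suc k)) - w (Suc k) - (1 / \<sigma> k) *\<^sub>R (lam (Suc k) - lam k) = h1 (Suc k)" for k
    using \<open>0 < \<sigma> k\<close> by (simp add: lam)
  ultimately have "(\<lambda>k. h1 (Suc k)) \<longlonglongrightarrow> fst (descent \<xi>s)"
    by (simp add: descent_def us_def ws_def)
  note h1_lim = this
  have "(\<lambda>k. symgrad (w (Suc k)) - (1 / \<sigma> k) *\<^sub>R (mu (Suc k) - mu k))
      \<longlonglongrightarrow> symgrad ws - (1 / \<sigma>inf) *\<^sub>R (mus - mus)"
    using \<sigma>inf by (intro tendsto_intros bounded_linear.tendsto[OF linear_symgrad[unfolded linear_conv_bounded_linear]] uw_lim LIMSEQ_Suc mu_lim \<open>\<sigma> \<longlonglongrightarrow> \<sigma>inf\<close>) simp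
  moreover have "symgrad (w (Suc k)) - (1 / \<sigma> k) *\<^sub>R (mu (Suc k) - mu k) = h2 (Suc k)" for k
    using \<open>0 < \<sigma> k\<close> by (simp add: mu)
  ultimately have h2_lim: "(\<lambda>k. h2 (Suc k)) \<longlonglongrightarrow> snd (descent \<xi>s)"
    by (simp add: descent_def ws_def)
  have lim: "(\<lambda>k. (u k, w k, h1 k, h2 k, lam k, mu k))
      \<longlonglongrightarrow> (us, ws, fst (descent \<xi>s), snd (descent \<xi>s), lams, mus)"
    by (intro tendsto_Pair lam_lim mu_lim uw_lim[THEN LIMSEQ_imp_Suc] h1_lim[THEN LIMSEQ_imp_Suc]
        h2_lim[THEN LIMSEQ_imp_Suc])
  have saddle: "saddle_point (L s) (us, ws, fst (descent \<xi>s), snd (descent \<xi>s)) (lams, mus)" if "0 < s" for s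
    using dual_solution_saddle_point[OF \<xi>s(3)[unfolded T_def] that]
    by (simp only: L_def us_def ws_def ms[symmetric])
  have rate: "\<forall>\<^sub>F k in sequentially. infdist (\<xi> (Suc k)) X
      \<le> (\<kappa> * (\<kappa>\<^sup>2 + (\<sigma> k)\<^sup>2) powr (- 1/2) + \<delta> k) * inverse (1 - \<delta> k) * infdist (\<xi> k) X"
    if sub: "metrically_subregular T (lams, mus) 0 \<kappa>" and \<delta>: "\<And>k. 0 \<le> \<delta> k" "summable \<delta>"
      and B1: "\<And>k. \<Phi> k (u (Suc k), w (Suc k), h1 (Suc k), h2 (Suc k)) - (INF x. \<Phi> k x)
                \<le> (\<delta> k)\<^sup>2 / (2 * \<sigma> k)
                   * ((norm (lam (Suc k) - lam k))\<^sup>2 + (norm (mu (Suc k) - mu k))\<^sup>2)" for \<kappa> \<delta>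
  proof -
    \<comment> \<open>the second criterion is the first one with a tolerance relative to the step length\<close>
    have err': "norm (\<xi> (Suc k) - \<eta> k) \<le> \<delta> k * norm (\<xi> (Suc k) - \<xi> k)" for k
    proof (rule err)
      show "0 \<le> \<delta> k * norm (\<xi> (Suc k) - \<xi> k)" using \<delta>(1) by simp
      have "(\<delta> k * norm (\<xi> (Suc k) - \<xi> k))\<^sup>2
          = (\<delta> k)\<^sup>2 * ((norm (lam (Suc k) - lam k))\<^sup>2 + (norm (mu (Suc k) - mu k))\<^sup>2)"
        by (simp add: \<xi>_def norm_Pair power_mult_distrib)
      then show "\<Phi> k (u (Suc k), w (Suc k), h1 (Suc k), h2 (Suc k)) - (INF x. \<Phi> k x)
          \<le> (\<delta> k * norm (\<xi> (Suc k) - \<xi> k))\<^sup>2 / (2 * \<sigma> k)"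
        using B1[of k] by simp
    qed
    show ?thesis
      unfolding X
      by (rule inexact_proximal_point_rate[OF monotone_subdifferential_dual[folded T_def]
            sub[folded ms] \<open>0 < \<sigma> _\<close> A_step \<xi>s(2) v0 err' \<delta>(1) summable_LIMSEQ_zero[OF \<delta>(2)]])
  qed
  show ?thesis
  proof (rule conjI[OF convergent_imp_bounded[OF lim]], (rule exI)+, intro conjI allI impI)
    show "(\<lambda>k. (u k, w k, h1 k, h2 k, lam k, mu k))
      \<longlonglongrightarrow> (us, ws, fst (descent \<xi>s), snd (descent \<xi>s), lams, mus)" by (rule lim)
    show "saddle_point (L s) (us, ws, fst (descent \<xi>s), snd (descent \<xi>s)) (lams, mus)" if "0 < s" for s
      by (rule saddle[OF that])
    fix lamb mub assume "assumption_E K f0 \<nu> a \<alpha>0 \<alpha>1 lamb mub"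
    then show "\<exists>\<kappa>. metrically_subregular T (lamb, mub) 0 \<kappa>"
      unfolding T_def by (rule assumption_E_metrically_subregular)
    fix \<kappa> \<delta>
    assume *: "metrically_subregular T (lamb, mub) 0 \<kappa> \<and> (\<forall>k. 0 \<le> \<delta> k) \<and> summable \<delta> \<and>
           (\<forall>k. \<Phi> k (u (Suc k), w (Suc k), h1 (Suc k), h2 (Suc k)) - (INF x. \<Phi> k x)
                \<le> (\<delta> k)\<^sup>2 / (2 * \<sigma> k)
                   * ((norm (lam (Suc k) - lam k))\<^sup>2 + (norm (mu (Suc k) - mu k))\<^sup>2))"
    then have \<kappa>: "0 \<le> \<kappa>" and \<delta>: "\<And>k. 0 \<le> \<delta> k" "summable \<delta>"
      by (auto simp: metrically_subregular_def)
    show "let \<xi> = (\<lambda>k. (lam k, mu k));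
                \<theta> = (\<lambda>k. (\<kappa> * (\<kappa>\<^sup>2 + (\<sigma> k)\<^sup>2) powr (- 1/2) + \<delta> k) * inverse (1 - \<delta> k));
                \<theta>inf = \<kappa> * (\<kappa>\<^sup>2 + \<sigma>inf\<^sup>2) powr (- 1/2)
            in \<xi> \<longlonglongrightarrow> (lams, mus) \<and> (lams, mus) \<in> X \<and>
               (metrically_subregular T (lams, mus) 0 \<kappa> \<longrightarrow>
                  (\<forall>\<^sub>F k in sequentially. infdist (\<xi> (Suc k)) X \<le> \<theta> k * infdist (\<xi> k) X)) \<and>
               \<theta> \<longlonglongrightarrow> \<theta>inf \<and> \<theta>inf < 1"
      unfolding Let_def \<xi>_def[symmetric]
    proof (intro conjI impI)
      show "\<xi> \<longlonglongrightarrow> (lams, mus)" "(lams, mus) \<in> X" using \<xi>s by (simp_all add: ms X)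
      show "\<forall>\<^sub>F k in sequentially. infdist (\<xi> (Suc k)) X
          \<le> (\<kappa> * (\<kappa>\<^sup>2 + (\<sigma> k)\<^sup>2) powr (- 1/2) + \<delta> k) * inverse (1 - \<delta> k) * infdist (\<xi> k) X"
        if "metrically_subregular T (lams, mus) 0 \<kappa>"
        by (rule rate[OF that \<delta>]) (use * in blast)
    qed (rule subregular_rate_tendsto[OF \<sigma>inf \<open>\<sigma> \<longlonglongrightarrow> \<sigma>inf\<close> summable_LIMSEQ_zero[OF \<delta>(2)]],
         rule subregular_rate_less_one[OF \<kappa> \<sigma>inf])
  qed
qed

end
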